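(* Consider the SUPER-ADAM algorithm with $\tau=1$ applied to $\min_{x\in\mathcal{X}} f(x)=\mathbb{E}_{\xi\sim\mathcal{D}}[f(x;\xi)]$, where $\mathcal{X}\subset\mathbb{R}^d$ is a nonempty compact convex set. Assume: (1) there is $\sigma>0$ such that for all $x\in\mathcal{X}$, $\mathbb{E}[\nabla f(x;\xi)]=\nabla f(x)$ and $\mathbb{E}\|\nabla f(x;\xi)-\nabla f(x)\|^2\le\sigma^2$; (2) $f$ is bounded below on $\mathcal{X}$, with $f^*=\inf_{x\in\mathcal{X}}f(x)>-\infty$; (3) there is $\rho>0$ such that $H_t\succeq\rho I_d$ for all $t\ge1$; (4) there is $L>0$ such that for every $\xi$, $\|\nabla f(x;\xi)-\nabla f(y;\xi)\|\le L\|x-y\|$ for all $x,y\in\mathcal{X}$. Let $k>0$, $m\ge\max\big(\tfrac32,\,k^3,\,\tfrac{8^{3/2}}{(3k)^{3/2}}\big)$, $0<\gamma\le\frac{\rho m^{1/3}}{4kL}$, $\frac{1}{k^3}+\frac{10L^2\gamma^2}{\rho^2}\le c\le\frac{m^{2/3}}{k^2}$, and for all $t\ge0$ let $\mu_t=\frac{k}{(m+t)^{1/3}}$ and $\alpha_{t+1}=c\mu_t^2$. Then for every integer $T\ge1$, $$\frac1T\sum_{t=1}^T\mathbb{E}\|\mathcal{G}_{\mathcal{X}}(x_t,\nabla f(x_t),\gamma)\|\le\frac1T\sum_{t=1}^T\mathbb{E}[\mathcal{M}_t]\le\frac{2\sqrt{2G}\,m^{1/6}}{T^{1/2}}+\frac{2\sqrt{2G}}{T^{1/3}},$$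 where $G=\frac{f(x_1)-f^*}{k\rho\gamma}+\frac{m^{1/3}\sigma^2}{8k^2L^2\gamma^2}+\frac{k^2c^2\sigma^2}{4L^2\gamma^2}\ln(m+T)$.
   Context: Norms: $\|\cdot\|$ is the $\ell_2$ norm for vectors and the spectral norm for matrices. $f(\cdot;\xi)$ and $f$ are differentiable (on an open set containing $\mathcal{X}$), and $f$ may be nonconvex; gradients are with respect to $x$. SUPER-ADAM algorithm. Inputs: $\tau\in\{0,1\}$, constant $\gamma>0$, parameters $\mu_t\in(0,1]$, $\alpha_{t+1}\in(0,1]$, and a deterministic starting point $x_1\in\mathcal{X}$. The samples $\xi_1,\xi_2,\dots$ are drawn independently from $\mathcal{D}$. Set $g_1=\nabla f(x_1;\xi_1)$. For $t=1,2,\dots$: (i) generate a symmetric matrix $H_t\in\mathbb{R}^{d\times d}$ by any rule depending (measurably) only on the information available so far, i.e. on $\xi_1,\dots,\xi_t$; (ii) $\tilde{x}_{t+1}=\arg\min_{x\in\mathcal{X}}\{\langle g_t,x\rangle+\frac{1}{2\gamma}(x-x_t)^TH_t(x-x_t)\}$; (iii) $x_{t+1}=(1-\mu_t)x_t+\mu_t\tilde{x}_{t+1}$; (iv) draw $\xi_{t+1}$ and set $g_{t+1}=\alpha_{t+1}\nabla f(x_{t+1};\xi_{t+1})+(1-\alpha_{t+1})\big[g_t+\tau\big(\nabla f(x_{t+1};\xi_{t+1})-\nabla f(x_t;\xi_{t+1})\big)\big]$. Convergence measure: $\mathcal{M}_t=\frac1\rho\|\nabla f(x_t)-g_t\|+\frac1\gamma\|\tilde{x}_{t+1}-x_t\|$.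 Gradient mapping: $\mathcal{G}_{\mathcal{X}}(x_t,\nabla f(x_t),\gamma)=\frac1\gamma(x_t-x_{t+1}^+)$, where $x_{t+1}^+=\arg\min_{x\in\mathcal{X}}\{\langle\nabla f(x_t),x\rangle+\frac{1}{2\gamma}(x-x_t)^TH_t(x-x_t)\}$. $\mathbb{E}$ denotes expectation over all the samples. *)

theory Defs
  imports "HOL-Probability.Probability"
begin

definition gradient :: "('a::real_inner \<Rightarrow> real) \<Rightarrow> 'a \<Rightarrow> 'a" where
  "gradient f x = (THE D. GDERIV f x :> D)"

definition pos_semidef :: "real^'n^'n \<Rightarrow> bool" where
  "pos_semidef A \<longleftrightarrow> transpose A = A \<and> (\<forall>v. 0 \<le> v \<bullet> (A *v v))"

definition loewner_ge :: "real^'n^'n \<Rightarrow> real^'n^'n \<Rightarrow> bool" where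
  "loewner_ge A B \<longleftrightarrow> pos_semidef (A - B)"

text \<open>For compact convex nonempty \<open>X\<close> and positive definite \<open>H\<close> the minimizer exists and is
  unique, so the choice hidden in \<^const>\<open>arg_min_on\<close> is immaterial.\<close>

definition prox_step ::
  "(real^'n) set \<Rightarrow> real \<Rightarrow> real^'n^'n \<Rightarrow> real^'n \<Rightarrow> real^'n \<Rightarrow> real^'n" where
  "prox_step X \<gamma> H x v =
     arg_min_on (\<lambda>y. v \<bullet> y + 1 / (2 * \<gamma>) * ((y - x) \<bullet> (H *v (y - x)))) X"

definition gradient_mapping ::
  "(real^'n) set \<Rightarrow> real^'n^'n \<Rightarrow> real^'n \<Rightarrow> real^'n \<Rightarrow> real \<Rightarrow> real^'n" where
  "gradient_mapping X H x v \<gamma> = (1 / \<gamma>) *\<^sub>R (x - prox_step X \<gamma> H x v)"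

text \<open>One sample path of the algorithm: \<open>F x s\<close> is the loss \<open>f(x;s)\<close> and \<open>z t\<close> the sample used
  for \<open>g t\<close>. All sequences start at index 1, except that \<open>xt (Suc t)\<close> and \<open>\<alpha> (Suc t)\<close> start at
  index 2; values at smaller indices are unconstrained.\<close>

definition super_adam_run ::
  "(real^'n) set \<Rightarrow> (real^'n \<Rightarrow> 's \<Rightarrow> real) \<Rightarrow> real \<Rightarrow> real \<Rightarrow> (nat \<Rightarrow> real) \<Rightarrow> (nat \<Rightarrow> real) \<Rightarrow> real^'n \<Rightarrow>
   (nat \<Rightarrow> 's) \<Rightarrow> (nat \<Rightarrow> real^'n^'n) \<Rightarrow> (nat \<Rightarrow> real^'n) \<Rightarrow> (nat \<Rightarrow> real^'n) \<Rightarrow> (nat \<Rightarrow> real^'n) \<Rightarrow> bool" where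
  "super_adam_run X F \<tau> \<gamma> \<mu> \<alpha> x1 z H x xt g \<longleftrightarrow>
     \<tau> \<in> {0, 1} \<and> 0 < \<gamma> \<and> x1 \<in> X \<and>
     (\<forall>t\<ge>1. \<mu> t \<in> {0<..1} \<and> \<alpha> (Suc t) \<in> {0<..1}) \<and>
     x 1 = x1 \<and>
     g 1 = gradient (\<lambda>y. F y (z 1)) x1 \<and>
     (\<forall>t\<ge>1.
        transpose (H t) = H t \<and>
        xt (Suc t) = prox_step X \<gamma> (H t) (x t) (g t) \<and>
        x (Suc t) = (1 - \<mu> t) *\<^sub>R x t + \<mu> t *\<^sub>R xt (Suc t) \<and>
        g (Suc t) =
          \<alpha> (Suc t) *\<^sub>R gradient (\<lambda>y. F y (z (Suc t))) (x (Suc t)) +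
          (1 - \<alpha> (Suc t)) *\<^sub>R
            (g t + \<tau> *\<^sub>R (gradient (\<lambda>y. F y (z (Suc t))) (x (Suc t)) -
                            gradient (\<lambda>y. F y (z (Suc t))) (x t))))"

definition convergence_measure ::
  "real \<Rightarrow> real \<Rightarrow> (real^'n \<Rightarrow> real) \<Rightarrow> real^'n \<Rightarrow> real^'n \<Rightarrow> real^'n \<Rightarrow> real" where
  "convergence_measure \<rho> \<gamma> f x g x' =
     1 / \<rho> * norm (gradient f x - g) + 1 / \<gamma> * norm (x' - x)"

end

theory Submission
  imports Defs
begin

text \<open>
  With \<open>d\<^sub>t = xt (t+1) - x t\<close> and \<open>e\<^sub>t = \<nabla>f (x t) - g t\<close>, optimality of the proximal step and
  smoothness of \<open>f\<close> give
  \<open>f (x (t+1)) \<le> f (x t) + \<mu>\<^sub>t \<gamma>/\<rho> \<parallel>e\<^sub>t\<parallel>\<^sup>2 - \<rho> \<mu>\<^sub>t/(2\<gamma>) \<parallel>d\<^sub>t\<parallel>\<^sup>2\<close>. The error satisfies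
  \<open>e\<^sub>t\<^sub>+\<^sub>1 = (1 - \<alpha>) e\<^sub>t + noise\<close>, where the noise is centred given the past because the sample
  \<open>\<xi> (t+1)\<close> is fresh; hence
  \<open>E \<parallel>e\<^sub>t\<^sub>+\<^sub>1\<parallel>\<^sup>2 \<le> (1 - \<alpha>)\<^sup>2 E \<parallel>e\<^sub>t\<parallel>\<^sup>2 + 2 \<alpha>\<^sup>2 \<sigma>\<^sup>2 + 2 (1 - \<alpha>)\<^sup>2 L\<^sup>2 \<mu>\<^sub>t\<^sup>2 E \<parallel>d\<^sub>t\<parallel>\<^sup>2\<close>.
  Both inequalities are combined in a Lyapunov function, and the Cauchy-Schwarz inequality passes
  from squares to the averaged convergence measure.
\<close>

section \<open>The proximal step\<close>

text \<open>\<open>H t\<close> is any measurable function of the past samples that dominates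
  \<open>\<rho>\<close> times the identity. Two measurability questions therefore come before any
  expectation: the proximal step is a choice operator applied to random data, and the sample
  gradient is evaluated at a random point although its joint measurability is not given. Stability
  answers both. Strong convexity makes the minimizer continuous in matrix, point and linear term;
  the Lipschitz property recovers sample gradients from a countable dense set.

  Freshness enters as a product law for the pair of past and next sample, so Tonelli takes the place
  of conditional expectations, and integrability of the squared error is propagated together with
  its bound.

  The Lyapunov weight on the error has to be of order \<open>1 / \<mu>\<close>: the error recursion
  injects \<open>\<mu>\<^sup>2 * b\<close>, while the descent inequality pays back only
  \<open>\<mu> * b\<close>. With this weight the variance contributes
  \<open>c\<^sup>2 * \<mu> ^ 3\<close>, a multiple of \<open>1 / (m + t)\<close>; its sum is the
  logarithm in \<open>G\<close>, and this is the origin of the exponent 1/3 in the step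
  size.\<close>

lemma gradient_eqI:
  assumes "GDERIV f x :> D"
  shows "gradient f x = D"
  unfolding gradient_def
proof (rule the_equality)
  fix E assume "GDERIV f x :> E"
  then have "(\<lambda>h. h \<bullet> E) = (\<lambda>h. h \<bullet> D)"
    using assms has_derivative_unique unfolding gderiv_def by blast
  then have "h \<bullet> (E - D) = 0" for h
    by (metis inner_diff_right right_minus_eq)
  then show "E = D"
    by (metis inner_eq_zero_iff right_minus_eq)
qed (fact assms)

lemma GDERIV_gradient:
  fixes f :: "'a::euclidean_space \<Rightarrow> real"
  assumes "f differentiable (at x)"
  shows "GDERIV f x :> gradient f x"
proof -
  obtain f' where f': "(f has_derivative f') (at x)"
    using assms by (auto simp: differentiable_def)
  have lin: "linear f'"
    using f' has_derivative_linear by blast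
  \<comment> \<open>\<open>adjoint f' 1\<close> is the Riesz vector of the functional
    \<open>f'\<close>.\<close>
  have "f' = (\<lambda>h. h \<bullet> adjoint f' 1)"
    using adjoint_works[OF lin, of _ 1] by (simp add: fun_eq_iff)
  then have "GDERIV f x :> adjoint f' 1"
    using f' unfolding gderiv_def by simp
  then show ?thesis
    using gradient_eqI by metis
qed

text \<open>Subtracting the quadratic majorant from \<open>f\<close> along the segment leaves a
  function of \<open>s\<close> whose derivative is nonpositive by Cauchy-Schwarz, so monotonicity
  replaces integration of the gradient.\<close>

lemma lipschitz_gradient_upper_bound:
  fixes f :: "'a::euclidean_space \<Rightarrow> real"
  assumes X: "convex X" and xy: "x \<in> X" "y \<in> X"
    and diff: "\<And>z. z \<in> X \<Longrightarrow> f differentiable (at z)"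
    and lip: "\<And>z. z \<in> X \<Longrightarrow> norm (gradient f z - gradient f x) \<le> L * norm (z - x)"
  shows "f y \<le> f x + gradient f x \<bullet> (y - x) + L / 2 * (norm (y - x))\<^sup>2"
proof -
  define d where "d = y - x"
  define \<phi> where "\<phi> s = f (x + s *\<^sub>R d) - s * (gradient f x \<bullet> d) - L / 2 * s\<^sup>2 * (norm d)\<^sup>2" for s
  have "\<phi> 1 \<le> \<phi> 0"
  proof (rule DERIV_nonpos_imp_nonincreasing[where f = \<phi> and a = 0 and b = 1])
    fix s :: real assume s: "0 \<le> s" "s \<le> 1"
    have z: "x + s *\<^sub>R d \<in> X"
      using convexD_alt[OF X xy, of s] s by (simp add: d_def algebra_simps)
    have "(f has_derivative (\<lambda>h. h \<bullet> gradient f (x + s *\<^sub>R d))) (at (x + s *\<^sub>R d))"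
      using GDERIV_gradient[OF diff[OF z]] by (simp add: gderiv_def)
    moreover have "((\<lambda>s. x + s *\<^sub>R d) has_derivative (\<lambda>h. h *\<^sub>R d)) (at s)"
      by (auto intro!: derivative_eq_intros)
    ultimately have "((\<lambda>s. f (x + s *\<^sub>R d)) has_derivative
        (\<lambda>h. (h *\<^sub>R d) \<bullet> gradient f (x + s *\<^sub>R d))) (at s)"
      using has_derivative_compose by fastforce
    then have "((\<lambda>s. f (x + s *\<^sub>R d)) has_real_derivative
        d \<bullet> gradient f (x + s *\<^sub>R d)) (at s)"
      by (rule has_derivative_imp_has_field_derivative) simp
    then have der: "(\<phi> has_real_derivative
        d \<bullet> gradient f (x + s *\<^sub>R d) - gradient f x \<bullet> d - L * s * (norm d)\<^sup>2) (at s)"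
      unfolding \<phi>_def by (auto intro!: derivative_eq_intros)
    have "d \<bullet> gradient f (x + s *\<^sub>R d) - gradient f x \<bullet> d
        \<le> norm d * norm (gradient f (x + s *\<^sub>R d) - gradient f x)"
      using norm_cauchy_schwarz[of d "gradient f (x + s *\<^sub>R d) - gradient f x"]
      by (simp add: inner_diff_right inner_commute)
    moreover have "\<dots> \<le> norm d * (L * norm (s *\<^sub>R d))"
      using lip[OF z] by (intro mult_left_mono) auto
    moreover have "\<dots> = L * s * (norm d)\<^sup>2"
      using s by (simp add: power2_eq_square)
    ultimately have "d \<bullet> gradient f (x + s *\<^sub>R d) - gradient f x \<bullet> d - L * s * (norm d)\<^sup>2 \<le> 0"
      by linarith
    with der show "\<exists>D. (\<phi> has_real_derivative D) (at s) \<and> D \<le> 0"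
      by blast
  qed simp
  then show ?thesis
    by (simp add: \<phi>_def d_def)
qed

section \<open>Optimality and stability of the proximal step\<close>

lemma symmetric_matrix_inner:
  fixes A :: "real^'n^'n"
  assumes "transpose A = A"
  shows "u \<bullet> (A *v v) = (A *v u) \<bullet> v"
  by (metis assms dot_lmul_matrix transpose_matrix_vector)

lemma loewner_ge_scaled_identityD:
  fixes H :: "real^'n^'n"
  assumes "loewner_ge H (\<rho> *\<^sub>R mat 1)"
  shows "transpose H = H" "\<rho> * (norm v)\<^sup>2 \<le> v \<bullet> (H *v v)"
proof -
  have sym: "transpose (H - \<rho> *\<^sub>R mat 1) = H - \<rho> *\<^sub>R mat 1"
    and psd: "0 \<le> v \<bullet> ((H - \<rho> *\<^sub>R mat 1) *v v)"
    using assms by (auto simp: loewner_ge_def pos_semidef_def)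
  show "transpose H = H"
  proof (simp add: vec_eq_iff transpose_def, intro allI)
    fix i j
    show "H $ j $ i = H $ i $ j"
      using arg_cong[OF sym, of "\<lambda>A. A $ i $ j"] by (simp add: transpose_def mat_def split: if_splits)
  qed
  show "\<rho> * (norm v)\<^sup>2 \<le> v \<bullet> (H *v v)"
    using psd
    by (simp add: matrix_vector_mult_diff_rdistrib scaleR_matrix_vector_assoc[symmetric]
        inner_diff_right power2_norm_eq_inner)
qed

text \<open>\<open>prox_step\<close> is a choice operator and carries information only once some
  minimizer is known to exist; compactness and continuity of the objective provide one.\<close>

lemma prox_step_minimizes:
  fixes X :: "(real^'n) set"
  assumes "X \<noteq> {}" "compact X"
  shows "prox_step X \<gamma> H x v \<in> X"
    and "y \<in> X \<Longrightarrow>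
      v \<bullet> prox_step X \<gamma> H x v
        + 1 / (2 * \<gamma>) * ((prox_step X \<gamma> H x v - x) \<bullet> (H *v (prox_step X \<gamma> H x v - x)))
      \<le> v \<bullet> y + 1 / (2 * \<gamma>) * ((y - x) \<bullet> (H *v (y - x)))"
proof -
  define q where "q y = v \<bullet> y + 1 / (2 * \<gamma>) * ((y - x) \<bullet> (H *v (y - x)))" for y
  have cont: "continuous_on X q"
    unfolding q_def
    by (intro continuous_intros linear_continuous_on_compose[OF _ matrix_vector_mul_linear])
  obtain p where p: "p \<in> X" "\<And>y. y \<in> X \<Longrightarrow> q p \<le> q y"
    using continuous_attains_inf[OF assms(2,1) cont] by blast
  have eq: "prox_step X \<gamma> H x v = arg_min q (\<lambda>y. y \<in> X)"
    unfolding prox_step_def arg_min_on_def q_def ..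
  have "prox_step X \<gamma> H x v \<in> X \<and> (\<forall>y\<in>X. \<not> q y < q (prox_step X \<gamma> H x v))"
    unfolding eq by (rule arg_minI[where x = p]) (use p in \<open>auto simp: not_less\<close>)
  then show "prox_step X \<gamma> H x v \<in> X"
    and "y \<in> X \<Longrightarrow>
      v \<bullet> prox_step X \<gamma> H x v
        + 1 / (2 * \<gamma>) * ((prox_step X \<gamma> H x v - x) \<bullet> (H *v (prox_step X \<gamma> H x v - x)))
      \<le> v \<bullet> y + 1 / (2 * \<gamma>) * ((y - x) \<bullet> (H *v (y - x)))"
    by (auto simp: q_def not_less)
qed

text \<open>Along the segment from \<open>p\<close> to \<open>y\<close> the objective is quadratic
  in \<open>s\<close>, and its increment is exactly \<open>s * (a + s * b)\<close>; symmetry of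
  \<open>H\<close> merges the two cross terms. Minimality makes this nonnegative on (0,1], and
  dividing by \<open>s\<close> before letting \<open>s\<close> tend to 0 leaves
  \<open>0 \<le> a\<close>.\<close>

lemma prox_step_variational_inequality:
  fixes X :: "(real^'n) set"
  and x v :: "real^'n" and \<gamma> :: real
  assumes X: "X \<noteq> {}" "compact X" "convex X" and sym: "transpose H = H" and y: "y \<in> X"
  defines "p \<equiv> prox_step X \<gamma> H x v"
  shows "0 \<le> (v + (1 / \<gamma>) *\<^sub>R (H *v (p - x))) \<bullet> (y - p)"
proof -
  define a where "a = (v + (1 / \<gamma>) *\<^sub>R (H *v (p - x))) \<bullet> (y - p)"
  define b where "b = 1 / (2 * \<gamma>) * ((y - p) \<bullet> (H *v (y - p)))"
  have p: "p \<in> X"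
    unfolding p_def by (rule prox_step_minimizes[OF X(1,2)])
  have step: "0 \<le> a + s * b" if s: "0 < s" "s \<le> 1" for s
  proof -
    define z where "z = p + s *\<^sub>R (y - p)"
    have "z \<in> X"
      using convexD_alt[OF X(3) p y, of s] s by (simp add: z_def algebra_simps)
    then have "v \<bullet> p + 1 / (2 * \<gamma>) * ((p - x) \<bullet> (H *v (p - x)))
        \<le> v \<bullet> z + 1 / (2 * \<gamma>) * ((z - x) \<bullet> (H *v (z - x)))"
      unfolding p_def by (rule prox_step_minimizes[OF X(1,2)])
    moreover have "(z - x) \<bullet> (H *v (z - x)) = (p - x) \<bullet> (H *v (p - x))
        + 2 * s * ((H *v (p - x)) \<bullet> (y - p)) + s\<^sup>2 * ((y - p) \<bullet> (H *v (y - p)))"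
    proof -
      have expand: "(u + s *\<^sub>R w) \<bullet> (H *v (u + s *\<^sub>R w))
          = u \<bullet> (H *v u) + 2 * s * ((H *v u) \<bullet> w) + s\<^sup>2 * (w \<bullet> (H *v w))" for u w
        using symmetric_matrix_inner[OF sym, of u w]
        by (simp add: matrix_vector_right_distrib matrix_vector_mult_scaleR inner_add_left
            inner_add_right inner_commute power2_eq_square algebra_simps)
      have "z - x = (p - x) + s *\<^sub>R (y - p)"
        by (simp add: z_def)
      then show ?thesis
        by (simp only: expand)
    qed
    moreover have "v \<bullet> z = v \<bullet> p + s * (v \<bullet> (y - p))"
      by (simp add: z_def inner_add_right)
    moreover have "a = v \<bullet> (y - p) + 1 / \<gamma> * ((H *v (p - x)) \<bullet> (y - p))"
      by (simp add: a_def inner_add_left)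
    ultimately have "v \<bullet> p + 1 / (2 * \<gamma>) * ((p - x) \<bullet> (H *v (p - x)))
        \<le> v \<bullet> p + 1 / (2 * \<gamma>) * ((p - x) \<bullet> (H *v (p - x))) + s * (a + s * b)"
      by (simp add: b_def power2_eq_square add_divide_distrib ring_distribs mult.assoc)
    then have "0 \<le> s * (a + s * b)"
      by linarith
    then show ?thesis
      using s by (simp add: zero_le_mult_iff)
  qed
  have "((\<lambda>s. a + s * b) \<longlongrightarrow> a + 0 * b) (at_right 0)"
    by (intro tendsto_intros)
  moreover have "\<forall>\<^sub>F s in at_right 0. 0 \<le> a + s * b"
    using eventually_at_right_less[of 0] eventually_at_right_real[of 0 1]
    by (rule eventually_elim2) (auto intro: step)
  ultimately show ?thesis
    using tendsto_lowerbound[of "\<lambda>s. a + s * b" "a + 0 * b" "at_right 0" 0] by (simp add: a_def)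
qed

text \<open>Each optimality condition is tested at the other minimizer and the two are added. This
  leaves the quadratic form of \<open>H\<close> at \<open>p' - p\<close>, which is at least
  \<open>\<rho>\<close> times the squared norm, against a residual made of the changes of the data.
  With equal points and matrices it yields Lipschitz dependence on \<open>v\<close>; in full it
  yields continuity.\<close>

lemma prox_step_perturbation:
  fixes X :: "(real^'n) set" and x v x' v' :: "real^'n" and \<gamma> :: real
  assumes X: "X \<noteq> {}" "compact X" "convex X" and \<gamma>: "0 < \<gamma>"
    and H: "loewner_ge H (\<rho> *\<^sub>R mat 1)" and sym: "transpose H' = H'"
  defines "p \<equiv> prox_step X \<gamma> H x v" and "p' \<equiv> prox_step X \<gamma> H' x' v'"
  shows "\<rho> * norm (p - p')
    \<le> \<gamma> * norm (v - v') + norm (H *v (x' - x)) + norm ((H - H') *v (p' - x'))"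
proof -
  define e where "e = p' - p"
  \<comment> \<open>Writing \<open>p = p' - e\<close> splits off \<open>H *v e\<close> and leaves
    this residual. The change of matrix acts on \<open>p' - x'\<close>, which stays fixed when the
    primed data are the limit point of a continuity argument.\<close>
  let ?r = "\<gamma> *\<^sub>R (v - v') + H *v (x' - x) + (H - H') *v (p' - x')"
  have p: "p \<in> X" "p' \<in> X"
    unfolding p_def p'_def by (rule prox_step_minimizes[OF X(1,2)])+
  have "0 \<le> (v + (1 / \<gamma>) *\<^sub>R (H *v (p - x))) \<bullet> (p' - p)"
    unfolding p_def
    by (rule prox_step_variational_inequality[OF X loewner_ge_scaled_identityD(1)[OF H] p(2)])
  moreover have "0 \<le> (v' + (1 / \<gamma>) *\<^sub>R (H' *v (p' - x'))) \<bullet> (p - p')"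
    unfolding p'_def by (rule prox_step_variational_inequality[OF X sym p(1)])
  ultimately have "0 \<le> \<gamma> * ((v + (1 / \<gamma>) *\<^sub>R (H *v (p - x))) \<bullet> (p' - p)
      + (v' + (1 / \<gamma>) *\<^sub>R (H' *v (p' - x'))) \<bullet> (p - p'))"
    using \<gamma> by simp
  also have "\<dots> = (\<gamma> *\<^sub>R (v - v') + H *v (p - x) - H' *v (p' - x')) \<bullet> e"
    using \<gamma> by (simp add: e_def inner_add_left inner_diff_left inner_diff_right field_simps)
  also have "\<gamma> *\<^sub>R (v - v') + H *v (p - x) - H' *v (p' - x') = ?r - H *v e"
    by (simp add: e_def matrix_vector_mult_diff_distrib matrix_vector_mult_diff_rdistrib)
  also have "(?r - H *v e) \<bullet> e = ?r \<bullet> e - e \<bullet> (H *v e)"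
    by (simp only: inner_diff_left inner_commute[of "H *v e"])
  finally have "e \<bullet> (H *v e) \<le> ?r \<bullet> e"
    by linarith
  then have "\<rho> * (norm e)\<^sup>2 \<le> norm ?r * norm e"
    using loewner_ge_scaled_identityD(2)[OF H, of e] norm_cauchy_schwarz[of ?r e] by linarith
  then have "\<rho> * norm e \<le> norm ?r"
    by (cases "norm e = 0") (auto simp: power2_eq_square)
  also have "\<dots> \<le> norm (\<gamma> *\<^sub>R (v - v')) + norm (H *v (x' - x)) + norm ((H - H') *v (p' - x'))"
    by (intro norm_triangle_mono order_refl)
  finally show ?thesis
    using \<gamma> by (simp add: e_def norm_minus_commute)
qed

lemma prox_step_lipschitz:
  fixes X :: "(real^'n) set"
  assumes "X \<noteq> {}" "compact X" "convex X" "0 < \<gamma>" "loewner_ge H (\<rho> *\<^sub>R mat 1)"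
  shows "\<rho> * norm (prox_step X \<gamma> H x v - prox_step X \<gamma> H x v') \<le> \<gamma> * norm (v - v')"
  using prox_step_perturbation[OF assms loewner_ge_scaled_identityD(1)[OF assms(5)], of x v x v']
  by simp

text \<open>This is the variational inequality tested at the current point \<open>x\<close>; the
  quadratic form of \<open>H\<close> supplies the decrease.\<close>

lemma prox_step_descent:
  fixes X :: "(real^'n) set"
  assumes X: "X \<noteq> {}" "compact X" "convex X" and \<gamma>: "0 < \<gamma>"
    and H: "loewner_ge H (\<rho> *\<^sub>R mat 1)" and x: "x \<in> X"
  shows "v \<bullet> (prox_step X \<gamma> H x v - x) \<le> - (\<rho> / \<gamma>) * (norm (prox_step X \<gamma> H x v - x))\<^sup>2"
proof -
  define d where "d = prox_step X \<gamma> H x v - x"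
  have "0 \<le> (v + (1 / \<gamma>) *\<^sub>R (H *v d)) \<bullet> (x - prox_step X \<gamma> H x v)"
    unfolding d_def
    by (rule prox_step_variational_inequality[OF X loewner_ge_scaled_identityD(1)[OF H] x])
  also have "\<dots> = - (v \<bullet> d) - (1 / \<gamma>) * (d \<bullet> (H *v d))"
    by (simp add: d_def inner_diff_right inner_add_left inner_commute algebra_simps)
  finally have "v \<bullet> d \<le> - (1 / \<gamma>) * (d \<bullet> (H *v d))"
    by simp
  also have "\<dots> \<le> - (1 / \<gamma>) * (\<rho> * (norm d)\<^sup>2)"
    using loewner_ge_scaled_identityD(2)[OF H, of d] \<gamma> by (simp add: divide_right_mono)
  finally show ?thesis
    by (simp add: d_def)
qed

text \<open>The perturbation bound is a continuous function of the data that vanishes at the limit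
  point. Joint continuity, including the matrix, is what makes \<open>xt\<close> measurable for a
  random \<open>H t\<close>.\<close>

lemma continuous_on_prox_step:
  fixes X :: "(real^'n) set"
  assumes X: "X \<noteq> {}" "compact X" "convex X" and \<gamma>: "0 < \<gamma>" and \<rho>: "0 < \<rho>"
  shows "continuous_on ({H. loewner_ge H (\<rho> *\<^sub>R mat 1)} \<times> UNIV)
    (\<lambda>(H, x, v). prox_step X \<gamma> H x v)"
  unfolding continuous_on_def
proof safe
  fix H' :: "real^'n^'n" and x' v' :: "real^'n"
  assume H': "loewner_ge H' (\<rho> *\<^sub>R mat 1)"
  define S where "S = {H :: real^'n^'n. loewner_ge H (\<rho> *\<^sub>R mat 1)} \<times> (UNIV :: ((real^'n) \<times> (real^'n)) set)"
  let ?p' = "prox_step X \<gamma> H' x' v'"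
  let ?r = "\<lambda>(H, x, v). (\<gamma> * norm (v - v') + norm (H *v (x' - x)) + norm ((H - H') *v (?p' - x'))) / \<rho>"
  have "continuous_on UNIV ?r"
    unfolding matrix_vector_mult_def case_prod_beta using \<rho> by (intro continuous_intros) auto
  then have "(?r \<longlongrightarrow> ?r (H', x', v')) (at (H', x', v'))"
    unfolding continuous_on_def by blast
  then have "(?r \<longlongrightarrow> 0) (at (H', x', v'))"
    by simp
  then have r: "(?r \<longlongrightarrow> 0) (at (H', x', v') within S)"
    by (rule tendsto_within_subset) simp
  have "norm ((case z of (H, x, v) \<Rightarrow> prox_step X \<gamma> H x v) - ?p') \<le> ?r z" if "z \<in> S" for z
    using prox_step_perturbation[OF X \<gamma> _ loewner_ge_scaled_identityD(1)[OF H']] that \<rho>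
    by (auto simp: S_def field_simps)
  then have "\<forall>\<^sub>F z in at (H', x', v') within S.
      norm ((case z of (H, x, v) \<Rightarrow> prox_step X \<gamma> H x v) - ?p') \<le> ?r z"
    by (auto simp: eventually_at_filter)
  from Lim_null_comparison[OF this r]
  have "((\<lambda>(H, x, v). prox_step X \<gamma> H x v) \<longlongrightarrow> ?p') (at (H', x', v') within S)"
    by (simp add: Lim_null[symmetric])
  then show "((\<lambda>(H, x, v). prox_step X \<gamma> H x v) \<longlongrightarrow> prox_step X \<gamma> H' x' v')
      (at (H', x', v') within {H. loewner_ge H (\<rho> *\<^sub>R mat 1)} \<times> UNIV)"
    by (simp add: S_def)
qed

section \<open>Measurability and fresh samples\<close>

text \<open>Passing through the restricted Borel space allows an arbitrary set \<open>S\<close>; it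
  is used for the set of matrices above a multiple of the identity and for \<open>X\<close>.\<close>

lemma borel_measurable_continuous_on_compose:
  assumes "continuous_on S h" "u \<in> borel_measurable N" "\<And>\<omega>. \<omega> \<in> space N \<Longrightarrow> u \<omega> \<in> S"
  shows "(\<lambda>\<omega>. h (u \<omega>)) \<in> borel_measurable N"
  by (rule measurable_compose[OF measurable_restrict_space2 borel_measurable_continuous_on_restrict])
     (use assms in auto)

text \<open>The coordinates of \<open>h\<close> are recovered from a countable dense subset by the McShane formula
  \<open>h y s = (INF c. h c s + L * norm (y - c))\<close>.\<close>

lemma borel_measurable_lipschitz_compose:
  fixes h :: "'a::euclidean_space \<Rightarrow> 's \<Rightarrow> 'b::euclidean_space"
  assumes h: "\<And>y. y \<in> X \<Longrightarrow> h y \<in> borel_measurable D"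
    and lip: "\<And>s y z. s \<in> space D \<Longrightarrow> y \<in> X \<Longrightarrow> z \<in> X \<Longrightarrow> norm (h y s - h z s) \<le> L * norm (y - z)"
    and L: "0 \<le> L"
    and u: "u \<in> borel_measurable N" "\<And>\<omega>. \<omega> \<in> space N \<Longrightarrow> u \<omega> \<in> X"
    and \<zeta>: "\<zeta> \<in> measurable N D"
  shows "(\<lambda>\<omega>. h (u \<omega>) (\<zeta> \<omega>)) \<in> borel_measurable N"
proof -
  obtain C where C: "countable C" "C \<subseteq> X" "X \<subseteq> closure C"
    using separable by blast
  have eq: "h y s \<bullet> i = (INF c\<in>C. h c s \<bullet> i + L * norm (y - c))"
    if y: "y \<in> X" and s: "s \<in> space D" and i: "i \<in> Basis" for y s i
  proof -
    have close: "\<bar>h y s \<bullet> i - h c s \<bullet> i\<bar> \<le> L * norm (y - c)" if "c \<in> C" for c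
      using Basis_le_norm[OF i, of "h y s - h c s"] lip[OF s y] C(2) that
      by (fastforce simp: inner_diff_left)
    have low: "h y s \<bullet> i \<le> h c s \<bullet> i + L * norm (y - c)" if "c \<in> C" for c
      using close[OF that] by linarith
    then have bdd: "bdd_below ((\<lambda>c. h c s \<bullet> i + L * norm (y - c)) ` C)"
      by (rule bdd_belowI2)
    have "C \<noteq> {}"
      using C(3) y by auto
    then have "h y s \<bullet> i \<le> (INF c\<in>C. h c s \<bullet> i + L * norm (y - c))"
      using low by (rule cINF_greatest)
    moreover have "(INF c\<in>C. h c s \<bullet> i + L * norm (y - c)) \<le> h y s \<bullet> i"
    proof (rule field_le_epsilon)
      fix e :: real assume e: "0 < e"
      \<comment> \<open>One \<open>L\<close> pays for the Lipschitz bound and one for the penalty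
        \<open>L * norm (y - c)\<close>; the added 1 keeps the denominator positive when
        \<open>L = 0\<close>.\<close>
      then have "0 < e / (2 * L + 1)"
        using L by simp
      then obtain c where c: "c \<in> C" "dist c y < e / (2 * L + 1)"
        using C(3) y closure_approachable by blast
      have "2 * L * norm (y - c) \<le> (2 * L + 1) * norm (y - c)"
        by (simp add: algebra_simps)
      also have "\<dots> \<le> e"
        using c(2) L by (simp add: dist_norm norm_minus_commute field_simps)
      finally show "(INF c\<in>C. h c s \<bullet> i + L * norm (y - c)) \<le> h y s \<bullet> i + e"
        using close[OF c(1)] by (intro cINF_lower2[OF bdd c(1)]) linarith
    qed
    ultimately show ?thesis
      by simp
  qed
  show ?thesis
  proof (subst borel_measurable_euclidean_space, intro ballI)
    fix i :: 'b assume i: "i \<in> Basis"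
    have [measurable]: "(\<lambda>\<omega>. h c (\<zeta> \<omega>)) \<in> borel_measurable N" if "c \<in> C" for c
      using measurable_compose[OF \<zeta> h] C(2) that by auto
    have "(\<lambda>\<omega>. INF c\<in>C. h c (\<zeta> \<omega>) \<bullet> i + L * norm (u \<omega> - c)) \<in> borel_measurable N"
      using C(1) u(1) by measurable
    then show "(\<lambda>\<omega>. h (u \<omega>) (\<zeta> \<omega>) \<bullet> i) \<in> borel_measurable N"
      by (rule measurable_cong[THEN iffD1, rotated])
         (use eq[OF u(2) measurable_space[OF \<zeta>] i] in simp)
  qed
qed

text \<open>This is the sigma-algebra generated by the first \<open>t\<close> samples. As a pullback
  of a finite product, each of its events is literally a preimage of a product event, and a rule
  acting on sample tuples composes directly with the tuple map. Since its space is
  \<open>space M\<close>, the identity from \<open>M\<close> into it is a random element that stands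
  for the whole past.\<close>

definition history :: "'w measure \<Rightarrow> 's measure \<Rightarrow> (nat \<Rightarrow> 'w \<Rightarrow> 's) \<Rightarrow> nat \<Rightarrow> 'w measure" where
  "history M D \<xi> t =
    vimage_algebra (space M) (\<lambda>\<omega>. \<lambda>i\<in>{1..t}. \<xi> i \<omega>) (Pi\<^sub>M {1..t} (\<lambda>_. D))"

lemma space_history [simp]: "space (history M D \<xi> t) = space M"
  by (simp add: history_def)

context
  fixes M :: "'w measure" and D :: "'s measure" and \<xi> :: "nat \<Rightarrow> 'w \<Rightarrow> 's"
  assumes samples: "\<And>t. t \<ge> 1 \<Longrightarrow> \<xi> t \<in> measurable M D"
begin

lemma measurable_history_samples:
  "(\<lambda>\<omega>. \<lambda>i\<in>{1..t}. \<xi> i \<omega>) \<in> measurable (history M D \<xi> t) (Pi\<^sub>M {1..t} (\<lambda>_. D))"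
  unfolding history_def
  by (rule measurable_vimage_algebra1)
     (auto simp: space_PiM intro!: measurable_space[OF samples])

lemma measurable_history_sample:
  assumes "1 \<le> i" "i \<le> t"
  shows "\<xi> i \<in> measurable (history M D \<xi> t) D"
  using measurable_compose[OF measurable_history_samples measurable_component_singleton, of i t]
    assms by simp

lemma measurable_from_history:
  assumes "f \<in> measurable (history M D \<xi> t) K"
  shows "f \<in> measurable M K"
proof -
  have "(\<lambda>\<omega>. \<omega>) \<in> measurable M (history M D \<xi> t)"
    unfolding history_def
    by (intro measurable_vimage_algebra2 measurable_restrict samples) auto
  from measurable_compose[OF this assms] show ?thesis .
qed

lemma measurable_history_Suc:
  assumes "f \<in> measurable (history M D \<xi> t) K"
  shows "f \<in> measurable (history M D \<xi> (Suc t)) K"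
proof -
  have "(\<lambda>\<omega>. \<omega>) \<in> measurable (history M D \<xi> (Suc t)) (history M D \<xi> t)"
    unfolding history_def[of _ _ _ t]
    by (intro measurable_vimage_algebra2 measurable_restrict measurable_history_sample) auto
  from measurable_compose[OF this assms] show ?thesis .
qed

end

section \<open>Independence of the next sample from the past\<close>

context prob_space
begin

text \<open>Independence is needed for arbitrary history-measurable quantities, so the past enters
  as the identity map into \<open>history M D \<xi> t\<close>. It suffices to compare both measures
  on rectangles, where events of the past are pulled back from the product of the first
  \<open>t\<close> samples.\<close>

lemma distr_history_sample:
  assumes ind: "indep_vars (\<lambda>_. D) \<xi> {1..}"
  shows "distr M (history M D \<xi> t) (\<lambda>\<omega>. \<omega>) \<Otimes>\<^sub>M distr M D (\<xi> (Suc t))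
    = distr M (history M D \<xi> t \<Otimes>\<^sub>M D) (\<lambda>\<omega>. (\<omega>, \<xi> (Suc t) \<omega>))"
proof (rule pair_measure_eqI)
  let ?N = "history M D \<xi> t" and ?P = "\<lambda>I. Pi\<^sub>M I (\<lambda>_. D)" and ?\<Xi> = "\<lambda>I \<omega>. \<lambda>i\<in>I. \<xi> i \<omega>"
  have rv: "\<xi> i \<in> measurable M D" if "i \<ge> 1" for i
    using ind that by (auto simp: indep_vars_def)
  then have [measurable]: "\<xi> (Suc t) \<in> measurable M D"
    by simp
  have [measurable]: "(\<lambda>\<omega>. \<omega>) \<in> measurable M ?N"
    using measurable_from_history[OF rv measurable_ident] by (simp add: id_def)
  show "sigma_finite_measure (distr M ?N (\<lambda>\<omega>. \<omega>))" "sigma_finite_measure (distr M D (\<xi> (Suc t)))"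
    by (auto intro!: prob_space_imp_sigma_finite prob_space_distr)
  show "sets (distr M ?N (\<lambda>\<omega>. \<omega>) \<Otimes>\<^sub>M distr M D (\<xi> (Suc t)))
      = sets (distr M (?N \<Otimes>\<^sub>M D) (\<lambda>\<omega>. (\<omega>, \<xi> (Suc t) \<omega>)))"
    by (simp cong: sets_pair_measure_cong)
  fix A B
  assume "A \<in> sets (distr M ?N (\<lambda>\<omega>. \<omega>))" "B \<in> sets (distr M D (\<xi> (Suc t)))"
  then have A [measurable]: "A \<in> sets ?N" and B [measurable]: "B \<in> sets D"
    by auto
  have "?\<Xi> {1..t} \<in> space M \<rightarrow> space (?P {1..t})"
    using rv by (auto simp: space_PiM intro!: measurable_space[OF rv])
  from sets_vimage_algebra2[OF this]
  obtain A' where A': "A' \<in> sets (?P {1..t})" "A = ?\<Xi> {1..t} -` A' \<inter> space M"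
    using A by (auto simp: history_def)
  \<comment> \<open>\<open>indep_var_restrict\<close> speaks about tuples over disjoint index sets,
    so the single sample is treated as a tuple with one coordinate.\<close>
  define B' where "B' = {z \<in> space (?P {Suc t}). z (Suc t) \<in> B}"
  have B': "B' \<in> sets (?P {Suc t})"
    unfolding B'_def by measurable
  have "B \<subseteq> space D"
    using B by (rule sets.sets_into_space)
  then have B'_eq: "\<xi> (Suc t) -` B \<inter> space M = ?\<Xi> {Suc t} -` B' \<inter> space M"
    by (auto simp: B'_def space_PiM)
  have "indep_var (?P {1..t}) (?\<Xi> {1..t}) (?P {Suc t}) (?\<Xi> {Suc t})"
    by (rule indep_var_restrict[OF ind]) auto
  from indep_varD[OF this A'(1) B']
  have "prob ((\<lambda>\<omega>. (?\<Xi> {1..t} \<omega>, ?\<Xi> {Suc t} \<omega>)) -` (A' \<times> B') \<inter> space M)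
      = prob A * prob (\<xi> (Suc t) -` B \<inter> space M)"
    unfolding A'(2) B'_eq .
  moreover have "(\<lambda>\<omega>. (?\<Xi> {1..t} \<omega>, ?\<Xi> {Suc t} \<omega>)) -` (A' \<times> B') \<inter> space M
      = A \<inter> (\<xi> (Suc t) -` B \<inter> space M)"
    unfolding A'(2) B'_eq by auto
  moreover have "(\<lambda>\<omega>. (\<omega>, \<xi> (Suc t) \<omega>)) -` (A \<times> B) \<inter> space M = A \<inter> (\<xi> (Suc t) -` B \<inter> space M)"
    by auto
  moreover have "(\<lambda>\<omega>. \<omega>) -` A \<inter> space M = A"
    unfolding A'(2) by auto
  ultimately show "emeasure (distr M ?N (\<lambda>\<omega>. \<omega>)) A * emeasure (distr M D (\<xi> (Suc t))) B
      = emeasure (distr M (?N \<Otimes>\<^sub>M D) (\<lambda>\<omega>. (\<omega>, \<xi> (Suc t) \<omega>))) (A \<times> B)"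
    by (simp add: emeasure_distr emeasure_eq_measure ennreal_mult)
qed

text \<open>This plays the role of conditioning on the past. The nonnegative integral matters: it is
  applied to the next squared error before that error is known to be integrable.\<close>

lemma nn_integral_fresh_sample:
  assumes ind: "indep_vars (\<lambda>_. D) \<xi> {1..}" and distr: "distr M D (\<xi> (Suc t)) = D"
    and \<phi>: "\<phi> \<in> borel_measurable (history M D \<xi> t \<Otimes>\<^sub>M D)"
  shows "(\<integral>\<^sup>+\<omega>. \<phi> (\<omega>, \<xi> (Suc t) \<omega>) \<partial>M) = (\<integral>\<^sup>+\<omega>. \<integral>\<^sup>+s. \<phi> (\<omega>, s) \<partial>D \<partial>M)"
proof -
  let ?N = "history M D \<xi> t"
  have rv: "\<xi> i \<in> measurable M D" if "i \<ge> 1" for i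
    using ind that by (auto simp: indep_vars_def)
  then have \<xi> [measurable]: "\<xi> (Suc t) \<in> measurable M D"
    by simp
  have [measurable]: "(\<lambda>\<omega>. \<omega>) \<in> measurable M ?N"
    using measurable_from_history[OF rv measurable_ident] by (simp add: id_def)
  have joint: "distr M ?N (\<lambda>\<omega>. \<omega>) \<Otimes>\<^sub>M D = distr M (?N \<Otimes>\<^sub>M D) (\<lambda>\<omega>. (\<omega>, \<xi> (Suc t) \<omega>))"
    using distr_history_sample[OF ind, of t] by (simp add: distr)
  interpret D: prob_space D
    using prob_space_distr[OF \<xi>] by (simp add: distr)
  have "(\<integral>\<^sup>+\<omega>. \<phi> (\<omega>, \<xi> (Suc t) \<omega>) \<partial>M) = integral\<^sup>N (distr M ?N (\<lambda>\<omega>. \<omega>) \<Otimes>\<^sub>M D) \<phi>"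
    unfolding joint using \<phi> by (subst nn_integral_distr) auto
  also have "\<dots> = (\<integral>\<^sup>+\<omega>. \<integral>\<^sup>+s. \<phi> (\<omega>, s) \<partial>D \<partial>distr M ?N (\<lambda>\<omega>. \<omega>))"
    using \<phi> by (intro D.nn_integral_fst[symmetric]) (simp cong: measurable_cong_sets)
  also have "\<dots> = (\<integral>\<^sup>+\<omega>. \<integral>\<^sup>+s. \<phi> (\<omega>, s) \<partial>D \<partial>M)"
    using D.borel_measurable_nn_integral_fst[OF \<phi>] by (subst nn_integral_distr) auto
  finally show ?thesis .
qed

end

section \<open>The Lyapunov recursion\<close>

text \<open>By \<open>ln u \<le> u - 1\<close> at \<open>u = (x - 1) / x\<close>, each reciprocal is
  at most an increment of \<open>ln\<close>; the empty sum is covered by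
  \<open>0 \<le> ln m\<close>.\<close>

lemma sum_inverse_shift_le_ln:
  fixes m :: real
  assumes "1 \<le> m"
  shows "(\<Sum>t=1..T. 1 / (m + real t)) \<le> ln (m + real T)"
proof (induction T)
  case 0
  then show ?case using assms by simp
next
  case (Suc T)
  define x where "x = m + real (Suc T)"
  have x: "1 < x"
    using assms by (simp add: x_def)
  have "ln ((x - 1) / x) \<le> (x - 1) / x - 1"
    using x by (intro ln_le_minus_one) auto
  also have "\<dots> = - 1 / x"
    using x by (simp add: field_simps)
  finally have "ln (x - 1) + 1 / x \<le> ln x"
    using x by (simp add: ln_div)
  moreover have "x - 1 = m + real T"
    by (simp add: x_def)
  ultimately have "ln (m + real T) + 1 / x \<le> ln x"
    by simp
  moreover have "(\<Sum>t=1..Suc T. 1 / (m + real t)) = (\<Sum>t=1..T. 1 / (m + real t)) + 1 / x"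
    by (simp add: x_def)
  ultimately show ?case
    using Suc unfolding x_def[symmetric] by linarith
qed

text \<open>The Lyapunov function is \<open>\<phi> t + \<rho> / (8 * L\<^sup>2 * \<gamma> * \<mu> (t - 1)) * a t\<close>: the growth of
  \<open>1 / \<mu> t\<close> is absorbed by the part \<open>1 / k ^ 3\<close> of \<open>c\<close>, and the remaining part
  \<open>10 * L\<^sup>2 * \<gamma>\<^sup>2 / \<rho>\<^sup>2\<close> turns the positive error term of the descent inequality negative.\<close>

lemma momentum_lyapunov_bound:
  fixes a b \<phi> \<mu> :: "nat \<Rightarrow> real"
  assumes pos: "0 < \<rho>" "0 < \<gamma>" "0 < L" "0 < k" and m: "1 \<le> m" "k ^ 3 \<le> m"
    and c: "1 / k ^ 3 + 10 * L\<^sup>2 * \<gamma>\<^sup>2 / \<rho>\<^sup>2 \<le> c"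
    and \<mu>: "\<And>t. \<mu> t = k / (m + real t) powr (1 / 3)"
    and \<alpha>: "\<And>t. 1 \<le> t \<Longrightarrow> c * (\<mu> t)\<^sup>2 \<le> 1"
    and nonneg: "\<And>t. 1 \<le> t \<Longrightarrow> 0 \<le> a t" "\<And>t. 1 \<le> t \<Longrightarrow> 0 \<le> b t"
    and descent: "\<And>t. 1 \<le> t \<Longrightarrow>
      \<phi> (Suc t) \<le> \<phi> t + \<mu> t * \<gamma> / \<rho> * a t - \<rho> * \<mu> t / (2 * \<gamma>) * b t"
    and error: "\<And>t. 1 \<le> t \<Longrightarrow>
      a (Suc t) \<le> (1 - c * (\<mu> t)\<^sup>2)\<^sup>2 * a t + 2 * (c * (\<mu> t)\<^sup>2)\<^sup>2 * \<sigma>\<^sup>2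
        + 2 * (1 - c * (\<mu> t)\<^sup>2)\<^sup>2 * L\<^sup>2 * (\<mu> t)\<^sup>2 * b t"
    and a1: "a 1 \<le> \<sigma>\<^sup>2" and lower: "\<And>t. 1 \<le> t \<Longrightarrow> lb \<le> \<phi> t"
  shows "(\<Sum>t=1..T. a t / \<rho>\<^sup>2 + b t / \<gamma>\<^sup>2)
    \<le> 4 * ((\<phi> 1 - lb) / (k * \<rho> * \<gamma>) + m powr (1 / 3) * \<sigma>\<^sup>2 / (8 * k\<^sup>2 * L\<^sup>2 * \<gamma>\<^sup>2)
          + k\<^sup>2 * c\<^sup>2 * \<sigma>\<^sup>2 / (4 * L\<^sup>2 * \<gamma>\<^sup>2) * ln (m + real T)) * (m + real T) powr (1 / 3)"
proof -
  \<comment> \<open>\<open>K\<close> is chosen so that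
    \<open>2 * K * L\<^sup>2 = \<rho> / (4 * \<gamma>)\<close>: the drift in the error recursion
    then consumes half of the negative \<open>b\<close> term of the descent inequality. The sum
    \<open>w\<close> is what survives, namely the other half on \<open>b\<close> and a surplus of
    one quarter on \<open>a\<close>.\<close>
  define K where "K = \<rho> / (8 * L\<^sup>2 * \<gamma>)"
  define w where "w t = \<mu> t * (\<gamma> / (4 * \<rho>) * a t + \<rho> / (4 * \<gamma>) * b t)" for t
  have K: "0 < K"
    using pos by (simp add: K_def)
  have \<mu>_pos: "0 < \<mu> t" for t
    using pos m by (simp add: \<mu>)
  have \<mu>_cube: "(\<mu> t) ^ 3 = k ^ 3 / (m + real t)" for t
  proof -
    have "((m + real t) powr (1 / 3)) ^ 3 = m + real t"
      using m by (simp add: powr_power)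
    then show ?thesis
      by (simp add: \<mu> power_divide)
  qed
  \<comment> \<open>For consecutive cube roots \<open>u\<close>, \<open>v\<close> the difference of
    cubes is 1, so \<open>v - u\<close> is the reciprocal of \<open>v * v + u * v + u * u\<close>.
    The assumption \<open>k ^ 3 \<le> m\<close> gives \<open>k \<le> v\<close>, which bounds that
    reciprocal by \<open>1 / (v * k)\<close>.\<close>
  have growth: "1 / \<mu> (Suc t) \<le> 1 / \<mu> t + \<mu> (Suc t) / k ^ 3" for t
  proof -
    define u v where "u = (m + real t) powr (1 / 3)" and "v = (m + real (Suc t)) powr (1 / 3)"
    have cubes: "u ^ 3 = m + real t" "v ^ 3 = m + real t + 1"
      using m by (simp_all add: u_def v_def powr_power)
    have uv: "0 < u" "u \<le> v"
      using m unfolding u_def v_def by (auto intro!: powr_mono2)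
    have "k ^ 3 \<le> v ^ 3"
      using m cubes by simp
    then have kv: "k \<le> v"
      using uv by (simp add: power_mono_iff pos less_imp_le)
    have "v * k \<le> v * v" "0 \<le> u * v" "0 \<le> u * u"
      using uv kv by (auto intro: mult_left_mono)
    then have "v * k \<le> v * v + u * v + u * u"
      by linarith
    then have "(v - u) * (v * k) \<le> (v - u) * (v * v + u * v + u * u)"
      using uv by (intro mult_left_mono) auto
    also have "\<dots> = v ^ 3 - u ^ 3"
      by (simp add: power3_eq_cube algebra_simps)
    finally have "(v - u) * (v * k) \<le> 1"
      using cubes by simp
    then have "v - u \<le> 1 / (v * k)"
      using uv pos by (simp add: pos_le_divide_eq)
    then have "(v - u) / k \<le> 1 / (v * k) / k"
      using pos by (intro divide_right_mono) auto
    then show ?thesis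
      using uv pos unfolding \<mu> u_def[symmetric] v_def[symmetric]
      by (simp add: diff_divide_distrib power3_eq_cube mult_ac)
  qed
  \<comment> \<open>The weight of \<open>a t\<close> uses index \<open>t - 1\<close>, so that
    consecutive inequalities telescope. At \<open>t = 1\<close> it is \<open>K / \<mu> 0\<close>,
    the source of \<open>m powr (1 / 3)\<close> in the variance term of the final constant.\<close>
  have step: "\<phi> (Suc t) + K / \<mu> t * a (Suc t) + w t
      \<le> \<phi> t + K / \<mu> (t - 1) * a t + \<rho> * c\<^sup>2 * \<sigma>\<^sup>2 * k ^ 3 / (4 * L\<^sup>2 * \<gamma>) * (1 / (m + real t))"
    if t: "1 \<le> t" for t
  proof -
    define q where "q = c * (\<mu> t)\<^sup>2"
    have c_pos: "0 < c"
    proof -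
      have "0 < 1 / k ^ 3" "0 \<le> 10 * L\<^sup>2 * \<gamma>\<^sup>2 / \<rho>\<^sup>2"
        using pos by auto
      then show ?thesis
        using c by linarith
    qed
    have q: "0 \<le> q" "q \<le> 1"
      using c_pos \<alpha>[OF t] by (auto simp: q_def)
    have sq: "(1 - q)\<^sup>2 \<le> 1 - q"
      using q mult_left_mono[of "1 - q" 1 "1 - q"] by (simp add: power2_eq_square)
    have "K / \<mu> t * a (Suc t) \<le> K / \<mu> t * ((1 - q) * a t + 2 * q\<^sup>2 * \<sigma>\<^sup>2 + 2 * L\<^sup>2 * (\<mu> t)\<^sup>2 * b t)"
    proof (rule mult_left_mono)
      have "(1 - q)\<^sup>2 * a t \<le> (1 - q) * a t"
        using sq nonneg(1)[OF t] by (rule mult_right_mono)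
      moreover have "(1 - q)\<^sup>2 * (2 * L\<^sup>2 * (\<mu> t)\<^sup>2 * b t) \<le> 1 * (2 * L\<^sup>2 * (\<mu> t)\<^sup>2 * b t)"
        using sq q nonneg(2)[OF t] by (intro mult_right_mono) auto
      ultimately show "a (Suc t) \<le> (1 - q) * a t + 2 * q\<^sup>2 * \<sigma>\<^sup>2 + 2 * L\<^sup>2 * (\<mu> t)\<^sup>2 * b t"
        using error[OF t] unfolding q_def[symmetric] by (simp add: mult_ac)
    qed (use K \<mu>_pos[of t] in simp)
    also have "\<dots> = K * (1 / \<mu> t - c * \<mu> t) * a t + 2 * K * c\<^sup>2 * \<sigma>\<^sup>2 * (\<mu> t) ^ 3
        + \<rho> * \<mu> t / (4 * \<gamma>) * b t"
    proof -
      have "q / \<mu> t = c * \<mu> t" "q\<^sup>2 / \<mu> t = c\<^sup>2 * (\<mu> t) ^ 3" "(\<mu> t)\<^sup>2 / \<mu> t = \<mu> t"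
        using \<mu>_pos[of t] by (simp_all add: q_def power2_eq_square power3_eq_cube)
      moreover have "2 * K * L\<^sup>2 = \<rho> / (4 * \<gamma>)"
        using pos by (simp add: K_def)
      moreover have "K / \<mu> t * ((1 - q) * a t + 2 * q\<^sup>2 * \<sigma>\<^sup>2 + 2 * L\<^sup>2 * (\<mu> t)\<^sup>2 * b t)
          = K * (1 / \<mu> t - q / \<mu> t) * a t + 2 * K * \<sigma>\<^sup>2 * (q\<^sup>2 / \<mu> t)
            + (2 * K * L\<^sup>2) * ((\<mu> t)\<^sup>2 / \<mu> t) * b t"
        by (simp add: ring_distribs add_divide_distrib diff_divide_distrib mult_ac)
      ultimately show ?thesis
        by simp
    qed
    also have "K * (1 / \<mu> t - c * \<mu> t) * a t \<le> K * (1 / \<mu> (t - 1) - 10 * L\<^sup>2 * \<gamma>\<^sup>2 / \<rho>\<^sup>2 * \<mu> t) * a t"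
    proof (intro mult_right_mono mult_left_mono)
      have "(1 / k ^ 3 + 10 * L\<^sup>2 * \<gamma>\<^sup>2 / \<rho>\<^sup>2) * \<mu> t \<le> c * \<mu> t"
        using c \<mu>_pos[of t] by (intro mult_right_mono) auto
      moreover have "1 / \<mu> t \<le> 1 / \<mu> (t - 1) + \<mu> t / k ^ 3"
        using growth[of "t - 1"] t by simp
      ultimately show "1 / \<mu> t - c * \<mu> t \<le> 1 / \<mu> (t - 1) - 10 * L\<^sup>2 * \<gamma>\<^sup>2 / \<rho>\<^sup>2 * \<mu> t"
        by (simp add: distrib_right)
    qed (use K nonneg(1)[OF t] in auto)
    also have "K * (1 / \<mu> (t - 1) - 10 * L\<^sup>2 * \<gamma>\<^sup>2 / \<rho>\<^sup>2 * \<mu> t) * a t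
        = K / \<mu> (t - 1) * a t - 5 / 4 * (\<mu> t * \<gamma> / \<rho> * a t)"
    proof -
      \<comment> \<open>The constant 10 is calibrated here: of the factor 5/4, one unit cancels the
        positive error term of the descent inequality and 1/4 remains for \<open>w\<close>.\<close>
      have "K * (10 * L\<^sup>2 * \<gamma>\<^sup>2 / \<rho>\<^sup>2) = 5 / 4 * (\<gamma> / \<rho>)"
        using pos by (simp add: K_def power2_eq_square)
      moreover have "K * (1 / \<mu> (t - 1) - 10 * L\<^sup>2 * \<gamma>\<^sup>2 / \<rho>\<^sup>2 * \<mu> t) * a t
          = K / \<mu> (t - 1) * a t - (K * (10 * L\<^sup>2 * \<gamma>\<^sup>2 / \<rho>\<^sup>2)) * \<mu> t * a t"
        by (simp add: right_diff_distrib left_diff_distrib)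
      ultimately show ?thesis
        by simp
    qed
    also have "2 * K * c\<^sup>2 * \<sigma>\<^sup>2 * (\<mu> t) ^ 3
        = \<rho> * c\<^sup>2 * \<sigma>\<^sup>2 * k ^ 3 / (4 * L\<^sup>2 * \<gamma>) * (1 / (m + real t))"
      using pos by (simp add: K_def \<mu>_cube)
    finally have "K / \<mu> t * a (Suc t) \<le> K / \<mu> (t - 1) * a t - 5 / 4 * (\<mu> t * \<gamma> / \<rho> * a t)
        + \<rho> * c\<^sup>2 * \<sigma>\<^sup>2 * k ^ 3 / (4 * L\<^sup>2 * \<gamma>) * (1 / (m + real t)) + \<rho> * \<mu> t / (4 * \<gamma>) * b t"
      by simp
    moreover have "w t = 1 / 4 * (\<mu> t * \<gamma> / \<rho> * a t) + \<rho> * \<mu> t / (4 * \<gamma>) * b t"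
      by (simp add: w_def algebra_simps)
    moreover have "\<rho> * \<mu> t / (2 * \<gamma>) * b t = 2 * (\<rho> * \<mu> t / (4 * \<gamma>) * b t)"
      by simp
    ultimately show ?thesis
      using descent[OF t] by linarith
  qed
  have tele: "\<phi> (Suc T) + K / \<mu> T * a (Suc T) + (\<Sum>t=1..T. w t)
      \<le> \<phi> 1 + K / \<mu> 0 * a 1 + \<rho> * c\<^sup>2 * \<sigma>\<^sup>2 * k ^ 3 / (4 * L\<^sup>2 * \<gamma>) * (\<Sum>t=1..T. 1 / (m + real t))" for T
  proof (induction T)
    case (Suc T)
    then show ?case
      using step[of "Suc T"] by (simp add: distrib_left)
  qed simp
  have "(\<Sum>t=1..T. w t) \<le> \<phi> 1 - lb + K / \<mu> 0 * \<sigma>\<^sup>2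
      + \<rho> * c\<^sup>2 * \<sigma>\<^sup>2 * k ^ 3 / (4 * L\<^sup>2 * \<gamma>) * ln (m + real T)"
  proof -
    have "0 \<le> K / \<mu> T * a (Suc T)"
      using K \<mu>_pos[of T] nonneg(1)[of "Suc T"] by simp
    moreover have "K / \<mu> 0 * a 1 \<le> K / \<mu> 0 * \<sigma>\<^sup>2"
      using K \<mu>_pos[of 0] a1 by (intro mult_left_mono) auto
    moreover have "\<rho> * c\<^sup>2 * \<sigma>\<^sup>2 * k ^ 3 / (4 * L\<^sup>2 * \<gamma>) * (\<Sum>t=1..T. 1 / (m + real t))
        \<le> \<rho> * c\<^sup>2 * \<sigma>\<^sup>2 * k ^ 3 / (4 * L\<^sup>2 * \<gamma>) * ln (m + real T)"
      using sum_inverse_shift_le_ln[OF m(1)] pos by (intro mult_left_mono) auto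
    ultimately show ?thesis
      using tele[of T] lower[of "Suc T"] by linarith
  qed
  also have "\<dots> = k * \<rho> * \<gamma> * ((\<phi> 1 - lb) / (k * \<rho> * \<gamma>) + m powr (1 / 3) * \<sigma>\<^sup>2 / (8 * k\<^sup>2 * L\<^sup>2 * \<gamma>\<^sup>2)
          + k\<^sup>2 * c\<^sup>2 * \<sigma>\<^sup>2 / (4 * L\<^sup>2 * \<gamma>\<^sup>2) * ln (m + real T))" (is "_ = k * \<rho> * \<gamma> * ?G")
    using pos by (simp add: K_def \<mu> distrib_left power2_eq_square power3_eq_cube mult_ac)
  finally have bound: "(\<Sum>t=1..T. w t) \<le> k * \<rho> * \<gamma> * ?G" .
  \<comment> \<open>\<open>w t\<close> is the summand scaled by
    \<open>\<mu> t * \<rho> * \<gamma> / 4\<close>, and the last step size is the smallest. Dividing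
    by it later produces the factor \<open>(m + real T) powr (1 / 3)\<close>.\<close>
  have "\<mu> T * \<rho> * \<gamma> / 4 * (\<Sum>t=1..T. a t / \<rho>\<^sup>2 + b t / \<gamma>\<^sup>2) \<le> (\<Sum>t=1..T. w t)"
    unfolding sum_distrib_left
  proof (rule sum_mono)
    fix t assume t: "t \<in> {1..T}"
    have "\<mu> T \<le> \<mu> t"
      using t pos m unfolding \<mu> by (intro divide_left_mono powr_mono2 mult_pos_pos) auto
    then have "\<mu> T * (\<rho> * \<gamma> / 4 * (a t / \<rho>\<^sup>2 + b t / \<gamma>\<^sup>2)) \<le> \<mu> t * (\<rho> * \<gamma> / 4 * (a t / \<rho>\<^sup>2 + b t / \<gamma>\<^sup>2))"
      using pos nonneg[of t] t by (intro mult_right_mono) auto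
    moreover have "\<rho> * \<gamma> / 4 * (a t / \<rho>\<^sup>2 + b t / \<gamma>\<^sup>2) = \<gamma> / (4 * \<rho>) * a t + \<rho> / (4 * \<gamma>) * b t"
      using pos by (simp add: distrib_left power2_eq_square)
    moreover have "\<mu> T * (\<rho> * \<gamma> / 4 * (a t / \<rho>\<^sup>2 + b t / \<gamma>\<^sup>2))
        = \<mu> T * \<rho> * \<gamma> / 4 * (a t / \<rho>\<^sup>2 + b t / \<gamma>\<^sup>2)"
      by simp
    ultimately show "\<mu> T * \<rho> * \<gamma> / 4 * (a t / \<rho>\<^sup>2 + b t / \<gamma>\<^sup>2) \<le> w t"
      unfolding w_def by metis
  qed
  with bound have "\<mu> T * \<rho> * \<gamma> / 4 * (\<Sum>t=1..T. a t / \<rho>\<^sup>2 + b t / \<gamma>\<^sup>2) \<le> k * \<rho> * \<gamma> * ?G"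
    by linarith
  moreover define r S g where "r = (m + real T) powr (1 / 3)"
    and "S = (\<Sum>t=1..T. a t / \<rho>\<^sup>2 + b t / \<gamma>\<^sup>2)" and "g = ?G"
  ultimately have "(k * \<rho> * \<gamma>) * (S / (4 * r)) \<le> (k * \<rho> * \<gamma>) * g"
    by (simp add: \<mu> mult_ac)
  then have "S / (4 * r) \<le> g"
    by (rule mult_left_le_imp_le) (use pos in simp)
  moreover have "0 < r"
    using m by (simp add: r_def)
  ultimately have "S \<le> 4 * g * r"
    by (simp add: pos_divide_le_eq mult_ac)
  then show ?thesis
    unfolding r_def S_def g_def .
qed

text \<open>A ratio in (0,1] is at most its \<open>p\<close>-th power; this is applied to
  \<open>x / (x + y)\<close> and \<open>y / (x + y)\<close>, which add up to 1.\<close>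

lemma powr_subadditive:
  fixes x y p :: real
  assumes "0 < x" "0 < y" "0 \<le> p" "p \<le> 1"
  shows "(x + y) powr p \<le> x powr p + y powr p"
proof -
  have *: "(x + y) powr p * (z / (x + y)) \<le> z powr p" if "0 < z" "z \<le> x + y" for z
  proof -
    have "(x + y) powr p * (z / (x + y)) powr 1 \<le> (x + y) powr p * (z / (x + y)) powr p"
      using that assms by (intro mult_left_mono powr_mono') auto
    also have "\<dots> = z powr p"
      using that assms by (simp add: powr_divide)
    finally show ?thesis
      using that assms by simp
  qed
  have "(x + y) powr p = (x + y) powr p * (x / (x + y)) + (x + y) powr p * (y / (x + y))"
    using assms by (simp flip: distrib_left add_divide_distrib)
  also have "\<dots> \<le> x powr p + y powr p"
    using assms by (intro add_mono *) auto
  finally show ?thesis .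
qed

text \<open>Cauchy-Schwarz over \<open>t\<close> bounds the squared sum of \<open>u\<close> by
  \<open>T\<close> times the sum of squares. The square root turns the exponent 1/3 into 1/6,
  subadditivity separates \<open>m\<close> from \<open>T\<close>, and division by \<open>T\<close>
  leaves the powers -1/2 and 1/2 + 1/6 - 1 = -1/3.\<close>

lemma average_le_of_square_sum:
  fixes u v :: "nat \<Rightarrow> real"
  assumes T: "1 \<le> T" and m: "0 < m"
    and u: "\<And>t. t \<in> {1..T} \<Longrightarrow> (u t)\<^sup>2 \<le> 2 * v t"
    and v: "(\<Sum>t=1..T. v t) \<le> 4 * G * (m + real T) powr (1 / 3)"
  shows "1 / real T * (\<Sum>t=1..T. u t)
    \<le> 2 * sqrt (2 * G) * m powr (1 / 6) / real T powr (1 / 2) + 2 * sqrt (2 * G) / real T powr (1 / 3)"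
proof -
  define S where "S = (\<Sum>t=1..T. u t)"
  have "S\<^sup>2 \<le> real T * (\<Sum>t=1..T. (u t)\<^sup>2)"
    using Cauchy_Schwarz_ineq_sum[of "\<lambda>_. 1" u "{1..T}"] by (simp add: S_def)
  also have "\<dots> \<le> real T * (\<Sum>t=1..T. 2 * v t)"
    using u by (intro mult_left_mono sum_mono) auto
  also have "\<dots> \<le> real T * (8 * G * (m + real T) powr (1 / 3))"
    using v by (intro mult_left_mono) (auto simp flip: sum_distrib_left)
  finally have S: "S\<^sup>2 \<le> real T * (8 * G * (m + real T) powr (1 / 3))" .
  \<comment> \<open>The sign of \<open>G\<close> is extracted from the bound itself, which dominates
    a square; the monotonicity step below multiplies by \<open>sqrt (2 * G)\<close>.\<close>
  have "0 \<le> real T * (8 * G * (m + real T) powr (1 / 3))"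
    using S zero_le_power2[of S] by linarith
  then have G: "0 \<le> G"
    using T m by (simp add: zero_le_mult_iff)
  have sixth: "sqrt ((m + real T) powr (1 / 3)) = (m + real T) powr (1 / 6)"
    using m by (simp add: powr_powr flip: powr_half_sqrt)
  have "S \<le> sqrt (real T * (8 * G * (m + real T) powr (1 / 3)))"
    using S by (rule real_le_rsqrt)
  also have "\<dots> = sqrt (real T) * (2 * sqrt (2 * G)) * (m + real T) powr (1 / 6)"
  proof -
    have "sqrt (8 * G) = sqrt (2\<^sup>2 * (2 * G))"
      by simp
    also have "\<dots> = 2 * sqrt (2 * G)"
      unfolding real_sqrt_mult by simp
    finally show ?thesis
      unfolding sixth[symmetric] by (metis mult.assoc real_sqrt_mult)
  qed
  also have "\<dots> \<le> sqrt (real T) * (2 * sqrt (2 * G)) * (m powr (1 / 6) + real T powr (1 / 6))"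
    using G m T by (intro mult_left_mono powr_subadditive) auto
  finally have "1 / real T * S \<le>
      1 / real T * (sqrt (real T) * (2 * sqrt (2 * G)) * (m powr (1 / 6) + real T powr (1 / 6)))"
    by (intro mult_left_mono) auto
  also have "\<dots> = 2 * sqrt (2 * G) * m powr (1 / 6) * (sqrt (real T) / real T)
      + 2 * sqrt (2 * G) * (sqrt (real T) * real T powr (1 / 6) / real T)"
    by (simp add: algebra_simps)
  also have "sqrt (real T) / real T = 1 / real T powr (1 / 2)"
    using T by (simp add: powr_half_sqrt field_simps)
  also have "sqrt (real T) * real T powr (1 / 6) / real T = 1 / real T powr (1 / 3)"
  proof -
    have "sqrt (real T) * real T powr (1 / 6) * real T powr (1 / 3) = real T powr (1 / 2 + 1 / 6 + 1 / 3)"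
      by (simp only: powr_add powr_half_sqrt of_nat_0_le_iff)
    also have "\<dots> = real T"
      using T by simp
    finally show ?thesis
      using T by (simp add: field_simps)
  qed
  finally show ?thesis
    by (simp add: S_def)
qed

section \<open>Moments of the gradient error\<close>

context prob_space
begin

text \<open>The use of this identity is that centring cannot increase the second moment.\<close>

lemma expectation_norm_power2_centered:
  fixes Z :: "'a \<Rightarrow> 'b::euclidean_space"
  assumes Z: "integrable M Z" "integrable M (\<lambda>s. (norm (Z s))\<^sup>2)"
  shows "integrable M (\<lambda>s. (norm (expectation Z - Z s))\<^sup>2)"
    and "expectation (\<lambda>s. (norm (expectation Z - Z s))\<^sup>2)
      = expectation (\<lambda>s. (norm (Z s))\<^sup>2) - (norm (expectation Z))\<^sup>2"
proof -
  let ?m = "expectation Z"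
  have eq: "(norm (?m - Z s))\<^sup>2 = (norm (Z s))\<^sup>2 - 2 * (?m \<bullet> Z s) + (norm ?m)\<^sup>2" for s
    by (simp add: power2_norm_eq_inner inner_diff_left inner_diff_right inner_commute)
  show "integrable M (\<lambda>s. (norm (?m - Z s))\<^sup>2)"
    unfolding eq using Z by simp
  show "expectation (\<lambda>s. (norm (?m - Z s))\<^sup>2) = expectation (\<lambda>s. (norm (Z s))\<^sup>2) - (norm ?m)\<^sup>2"
    unfolding eq using Z by (simp add: prob_space power2_norm_eq_inner)
qed

text \<open>The cross term vanishes because \<open>V\<close> is centred. In the application
  \<open>e\<close> is the damped past error, constant once the past is frozen.\<close>

lemma expectation_norm_power2_add_noise:
  fixes V :: "'a \<Rightarrow> 'b::euclidean_space"
  assumes V: "integrable M V" "expectation V = 0" "integrable M (\<lambda>s. (norm (V s))\<^sup>2)"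
  shows "integrable M (\<lambda>s. (norm (e + V s))\<^sup>2)"
    and "expectation (\<lambda>s. (norm (e + V s))\<^sup>2) = (norm e)\<^sup>2 + expectation (\<lambda>s. (norm (V s))\<^sup>2)"
proof -
  have eq: "(norm (e + V s))\<^sup>2 = (norm e)\<^sup>2 + 2 * (e \<bullet> V s) + (norm (V s))\<^sup>2" for s
    by (simp add: power2_norm_eq_inner inner_add_left inner_add_right inner_commute)
  show "integrable M (\<lambda>s. (norm (e + V s))\<^sup>2)"
    unfolding eq using V by simp
  show "expectation (\<lambda>s. (norm (e + V s))\<^sup>2) = (norm e)\<^sup>2 + expectation (\<lambda>s. (norm (V s))\<^sup>2)"
    unfolding eq using V by (simp add: prob_space)
qed

lemma expectation_power2_le:
  fixes Y :: "'a \<Rightarrow> real"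
  assumes "integrable M Y" "integrable M (\<lambda>\<omega>. (Y \<omega>)\<^sup>2)"
  shows "(expectation Y)\<^sup>2 \<le> expectation (\<lambda>\<omega>. (Y \<omega>)\<^sup>2)"
  using variance_eq[OF assms] variance_positive[of Y] by linarith

lemma integrable_of_power2:
  fixes Y :: "'a \<Rightarrow> real"
  assumes "Y \<in> borel_measurable M" "integrable M (\<lambda>\<omega>. (Y \<omega>)\<^sup>2)"
  shows "integrable M Y"
proof (rule Bochner_Integration.integrable_bound)
  show "integrable M (\<lambda>\<omega>. 1 + (Y \<omega>)\<^sup>2)"
    using assms by simp
  have abs_le: "\<bar>y\<bar> \<le> 1 + y\<^sup>2" for y :: real
    using zero_le_power2[of "\<bar>y\<bar> - 1"] abs_ge_zero[of y] unfolding power2_diff by simp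
  show "AE \<omega> in M. norm (Y \<omega>) \<le> norm (1 + (Y \<omega>)\<^sup>2)"
    unfolding real_norm_def by (intro AE_I2 order_trans[OF abs_le abs_ge_self])
qed fact

end

lemma norm_add_power2_le:
  fixes u v :: "'a::real_inner"
  shows "(norm (u + v))\<^sup>2 \<le> 2 * (norm u)\<^sup>2 + 2 * (norm v)\<^sup>2"
proof -
  have "(norm (u + v))\<^sup>2 + (norm (u - v))\<^sup>2 = 2 * (norm u)\<^sup>2 + 2 * (norm v)\<^sup>2"
    by (simp add: power2_norm_eq_inner inner_add_left inner_add_right inner_diff_left inner_diff_right)
  then show ?thesis
    using zero_le_power2[of "norm (u - v)"] by linarith
qed

text \<open>A first-order oracle: \<open>h\<close> is later the gradient of the sample loss and
  \<open>grad\<close> the gradient of \<open>f\<close>.\<close>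

locale stochastic_gradient =
  D: prob_space D for D :: "'s measure" +
  fixes X :: "(real^'n) set" and h :: "real^'n \<Rightarrow> 's \<Rightarrow> real^'n" and grad :: "real^'n \<Rightarrow> real^'n"
    and \<sigma> L :: real
  assumes L_pos: "0 < L"
    and h_int: "\<And>y. y \<in> X \<Longrightarrow> integrable D (h y)"
    and unbiased: "\<And>y. y \<in> X \<Longrightarrow> D.expectation (h y) = grad y"
    and variance_int: "\<And>y. y \<in> X \<Longrightarrow> integrable D (\<lambda>s. (norm (h y s - grad y))\<^sup>2)"
    and variance_le: "\<And>y. y \<in> X \<Longrightarrow> D.expectation (\<lambda>s. (norm (h y s - grad y))\<^sup>2) \<le> \<sigma>\<^sup>2"
    and h_lipschitz: "\<And>s y z. s \<in> space D \<Longrightarrow> y \<in> X \<Longrightarrow> z \<in> X \<Longrightarrow>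
      norm (h y s - h z s) \<le> L * norm (y - z)"
begin

text \<open>Smoothness of the mean is inherited from the samples by moving the norm inside the
  expectation; the descent inequality relies on it.\<close>

lemma grad_lipschitz:
  assumes "y \<in> X" "z \<in> X"
  shows "norm (grad y - grad z) \<le> L * norm (y - z)"
proof -
  have "grad y - grad z = D.expectation (\<lambda>s. h y s - h z s)"
    using assms by (simp add: unbiased h_int)
  also have "norm \<dots> \<le> D.expectation (\<lambda>s. norm (h y s - h z s))"
    by (rule integral_norm_bound)
  also have "\<dots> \<le> D.expectation (\<lambda>_. L * norm (y - z))"
    using assms by (intro integral_mono integrable_norm Bochner_Integration.integrable_diff h_int h_lipschitz) auto
  finally show ?thesis
    by (simp add: D.prob_space)
qed

lemma continuous_on_grad: "continuous_on X grad"
proof (rule lipschitz_on_continuous_on)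
  show "L-lipschitz_on X grad"
    using L_pos grad_lipschitz by (intro lipschitz_onI) (auto simp: dist_norm)
qed

text \<open>With \<open>q = \<alpha> (Suc t)\<close> and \<open>y\<close>, \<open>z\<close> the old
  and new iterates, this is what remains of the new error after subtracting \<open>1 - q\<close>
  times the old one. Its second part is the error in estimating the change of the gradient with one
  sample used at both points, which is small when \<open>z\<close> is close to \<open>y\<close>;
  this is the gain from \<open>\<tau> = 1\<close>.\<close>

definition noise :: "real \<Rightarrow> real^'n \<Rightarrow> real^'n \<Rightarrow> 's \<Rightarrow> real^'n" where
  "noise q y z s = q *\<^sub>R (grad z - h z s) + (1 - q) *\<^sub>R ((grad z - grad y) - (h z s - h y s))"

text \<open>Both parts are centred by unbiasedness. The first has variance at most
  \<open>\<sigma>\<^sup>2\<close>; the second is the centred version of \<open>h z - h y\<close>,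
  whose norm is at most \<open>L * norm (z - y)\<close> for every sample. The factors 2 come from
  splitting the square of the sum.\<close>

lemma noise_moments:
  assumes y: "y \<in> X" and z: "z \<in> X"
  shows "integrable D (noise q y z)" "D.expectation (noise q y z) = 0"
    and "integrable D (\<lambda>s. (norm (noise q y z s))\<^sup>2)"
    and "D.expectation (\<lambda>s. (norm (noise q y z s))\<^sup>2)
      \<le> 2 * q\<^sup>2 * \<sigma>\<^sup>2 + 2 * (1 - q)\<^sup>2 * L\<^sup>2 * (norm (z - y))\<^sup>2"
proof -
  have int [simp]: "integrable D (h y)" "integrable D (h z)"
    using h_int y z by auto
  show n1: "integrable D (noise q y z)"
    unfolding noise_def[abs_def] by simp
  show "D.expectation (noise q y z) = 0"
    unfolding noise_def[abs_def] by (simp add: D.prob_space unbiased y z)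
  define Z where "Z s = h z s - h y s" for s
  have Z: "integrable D Z" "D.expectation Z = grad z - grad y"
    unfolding Z_def[abs_def] by (simp_all add: unbiased y z)
  have Z_le: "(norm (Z s))\<^sup>2 \<le> L\<^sup>2 * (norm (z - y))\<^sup>2" if "s \<in> space D" for s
    using power_mono[OF h_lipschitz[OF that z y], of 2] by (simp add: Z_def power_mult_distrib)
  have Z2: "integrable D (\<lambda>s. (norm (Z s))\<^sup>2)"
  proof (rule D.integrable_const_bound[where B = "L\<^sup>2 * (norm (z - y))\<^sup>2"])
    show "AE s in D. norm ((norm (Z s))\<^sup>2) \<le> L\<^sup>2 * (norm (z - y))\<^sup>2"
      using Z_le by auto
  qed (use Z(1) in measurable)
  have "D.expectation (\<lambda>s. (norm (Z s))\<^sup>2) \<le> D.expectation (\<lambda>_. L\<^sup>2 * (norm (z - y))\<^sup>2)"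
    using Z2 Z_le by (intro integral_mono) auto
  then have "D.expectation (\<lambda>s. (norm (Z s))\<^sup>2) \<le> L\<^sup>2 * (norm (z - y))\<^sup>2"
    by (simp add: D.prob_space)
  then have B_le: "D.expectation (\<lambda>s. (norm ((grad z - grad y) - Z s))\<^sup>2) \<le> L\<^sup>2 * (norm (z - y))\<^sup>2"
    using D.expectation_norm_power2_centered(2)[OF Z(1) Z2] zero_le_power2[of "norm (grad z - grad y)"]
    unfolding Z(2) by linarith
  have B: "integrable D (\<lambda>s. (norm ((grad z - grad y) - Z s))\<^sup>2)"
    using D.expectation_norm_power2_centered(1)[OF Z(1) Z2] by (simp add: Z(2))
  have A: "integrable D (\<lambda>s. (norm (grad z - h z s))\<^sup>2)"
    "D.expectation (\<lambda>s. (norm (grad z - h z s))\<^sup>2) \<le> \<sigma>\<^sup>2"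
    using variance_int[OF z] variance_le[OF z] by (simp_all add: norm_minus_commute)
  let ?b = "\<lambda>s. 2 * q\<^sup>2 * (norm (grad z - h z s))\<^sup>2 + 2 * (1 - q)\<^sup>2 * (norm ((grad z - grad y) - Z s))\<^sup>2"
  have le: "(norm (noise q y z s))\<^sup>2 \<le> ?b s" for s
    using norm_add_power2_le[of "q *\<^sub>R (grad z - h z s)" "(1 - q) *\<^sub>R ((grad z - grad y) - Z s)"]
    by (simp add: noise_def Z_def power_mult_distrib)
  have b: "integrable D ?b"
    using A B by simp
  show n2: "integrable D (\<lambda>s. (norm (noise q y z s))\<^sup>2)"
  proof (rule Bochner_Integration.integrable_bound[OF b])
    show "(\<lambda>s. (norm (noise q y z s))\<^sup>2) \<in> borel_measurable D"
      using borel_measurable_integrable[OF n1] by measurable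
    show "AE s in D. norm ((norm (noise q y z s))\<^sup>2) \<le> norm (?b s)"
      using order_trans[OF le abs_ge_self] by simp
  qed
  have "D.expectation (\<lambda>s. (norm (noise q y z s))\<^sup>2) \<le> D.expectation ?b"
    using le by (intro integral_mono n2 b)
  also have "\<dots> = 2 * q\<^sup>2 * D.expectation (\<lambda>s. (norm (grad z - h z s))\<^sup>2)
      + 2 * (1 - q)\<^sup>2 * D.expectation (\<lambda>s. (norm ((grad z - grad y) - Z s))\<^sup>2)"
    using A B by simp
  also have "\<dots> \<le> 2 * q\<^sup>2 * \<sigma>\<^sup>2 + 2 * (1 - q)\<^sup>2 * (L\<^sup>2 * (norm (z - y))\<^sup>2)"
    using A(2) B_le by (intro add_mono mult_left_mono) auto
  finally show "D.expectation (\<lambda>s. (norm (noise q y z s))\<^sup>2)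
      \<le> 2 * q\<^sup>2 * \<sigma>\<^sup>2 + 2 * (1 - q)\<^sup>2 * L\<^sup>2 * (norm (z - y))\<^sup>2"
    by (simp add: mult.assoc)
qed

text \<open>The nonnegative integral is the form in which this appears as the inner integral after
  the past has been frozen.\<close>

lemma error_second_moment:
  assumes "y \<in> X" "z \<in> X"
  shows "(\<integral>\<^sup>+s. ennreal ((norm (e + noise q y z s))\<^sup>2) \<partial>D)
    \<le> ennreal ((norm e)\<^sup>2 + 2 * q\<^sup>2 * \<sigma>\<^sup>2 + 2 * (1 - q)\<^sup>2 * L\<^sup>2 * (norm (z - y))\<^sup>2)"
proof -
  note V = noise_moments[OF assms, of q]
  have "(\<integral>\<^sup>+s. ennreal ((norm (e + noise q y z s))\<^sup>2) \<partial>D)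
      = ennreal (D.expectation (\<lambda>s. (norm (e + noise q y z s))\<^sup>2))"
    by (intro nn_integral_eq_integral D.expectation_norm_power2_add_noise V(1-3)) simp
  also have "\<dots> \<le> ennreal ((norm e)\<^sup>2 + 2 * q\<^sup>2 * \<sigma>\<^sup>2 + 2 * (1 - q)\<^sup>2 * L\<^sup>2 * (norm (z - y))\<^sup>2)"
    using D.expectation_norm_power2_add_noise(2)[OF V(1-3), of e] V(4) by (intro ennreal_leI) simp
  finally show ?thesis .
qed

end

section \<open>Deterministic estimates for a single step\<close>

lemma proximal_step_decrease:
  fixes X :: "(real^'n) set" and f :: "real^'n \<Rightarrow> real" and x g :: "real^'n" and \<gamma> \<mu> :: real
  assumes X: "X \<noteq> {}" "compact X" "convex X" and \<gamma>: "0 < \<gamma>" and \<rho>: "0 < \<rho>" and L: "0 < L"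
    and H: "loewner_ge H (\<rho> *\<^sub>R mat 1)" and x: "x \<in> X" and \<mu>: "0 < \<mu>" "\<mu> \<le> 1" "4 * L * \<gamma> * \<mu> \<le> \<rho>"
    and diff: "\<And>z. z \<in> X \<Longrightarrow> f differentiable (at z)"
    and lip: "\<And>z. z \<in> X \<Longrightarrow> norm (gradient f z - gradient f x) \<le> L * norm (z - x)"
  defines "p \<equiv> prox_step X \<gamma> H x g"
  shows "f ((1 - \<mu>) *\<^sub>R x + \<mu> *\<^sub>R p)
    \<le> f x + \<mu> * \<gamma> / \<rho> * (norm (gradient f x - g))\<^sup>2 - \<rho> * \<mu> / (2 * \<gamma>) * (norm (p - x))\<^sup>2"
proof -
  define d where "d = p - x"
  define e where "e = gradient f x - g"
  define y where "y = (1 - \<mu>) *\<^sub>R x + \<mu> *\<^sub>R p"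
  have p: "p \<in> X"
    unfolding p_def by (rule prox_step_minimizes[OF X(1,2)])
  have "y \<in> X"
    using convexD_alt[OF X(3) x p, of \<mu>] \<mu> by (simp add: y_def)
  moreover have yx: "y - x = \<mu> *\<^sub>R d"
    by (simp add: y_def d_def algebra_simps)
  ultimately have "f y \<le> f x + \<mu> * (gradient f x \<bullet> d) + L / 2 * \<mu>\<^sup>2 * (norm d)\<^sup>2"
    using lipschitz_gradient_upper_bound[OF X(3) x _ diff lip, of y]
    by (simp add: power_mult_distrib mult_ac)
  also have "gradient f x \<bullet> d = e \<bullet> d + g \<bullet> d"
    by (simp add: e_def inner_diff_left)
  \<comment> \<open>In units of \<open>\<rho> * \<mu> / \<gamma>\<close> times the squared norm of
    \<open>d\<close>, the proximal step gains 1, Young's inequality costs 1/4, and the smoothness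
    term costs at most 1/4 by the step size condition; the net gain is 1/2.\<close>
  also have "\<mu> * (e \<bullet> d + g \<bullet> d)
      \<le> \<mu> * ((\<gamma> / \<rho> * (norm e)\<^sup>2 + \<rho> / (4 * \<gamma>) * (norm d)\<^sup>2) + - (\<rho> / \<gamma>) * (norm d)\<^sup>2)"
  proof (intro mult_left_mono add_mono)
    \<comment> \<open>Young's inequality as a completed square, weighted so that \<open>d\<close>
      receives exactly \<open>\<rho> / (4 * \<gamma>)\<close>.\<close>
    have "0 \<le> (\<gamma> * (2 * norm e) - \<rho> * norm d)\<^sup>2 / (4 * \<gamma> * \<rho>)"
      using \<gamma> \<rho> by simp
    also have "\<dots> = \<gamma> / \<rho> * (norm e)\<^sup>2 + \<rho> / (4 * \<gamma>) * (norm d)\<^sup>2 - norm e * norm d"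
      using \<gamma> \<rho> by (simp add: power2_eq_square field_simps)
    finally show "e \<bullet> d \<le> \<gamma> / \<rho> * (norm e)\<^sup>2 + \<rho> / (4 * \<gamma>) * (norm d)\<^sup>2"
      using norm_cauchy_schwarz[of e d] by linarith
    show "g \<bullet> d \<le> - (\<rho> / \<gamma>) * (norm d)\<^sup>2"
      unfolding d_def p_def by (rule prox_step_descent[OF X \<gamma> H x])
  qed (use \<mu> in simp)
  also have "L / 2 * \<mu>\<^sup>2 * (norm d)\<^sup>2 \<le> \<rho> / (4 * \<gamma>) * \<mu> * (norm d)\<^sup>2"
  proof (rule mult_right_mono)
    have "4 * L * \<gamma> * \<mu> * \<mu> \<le> \<rho> * \<mu>"
      using \<mu> by (intro mult_right_mono) auto
    moreover have "0 \<le> \<rho> * \<mu>"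
      using \<rho> \<mu> by simp
    ultimately have "2 * L * \<gamma> * \<mu> * \<mu> \<le> \<rho> * \<mu>"
      by linarith
    then show "L / 2 * \<mu>\<^sup>2 \<le> \<rho> / (4 * \<gamma>) * \<mu>"
      using \<gamma> by (simp add: pos_le_divide_eq power2_eq_square mult_ac)
  qed simp
  finally show ?thesis
    by (simp add: y_def d_def e_def algebra_simps)
qed

text \<open>Replacing \<open>v\<close> by \<open>g\<close> moves the proximal point by at most
  \<open>\<gamma> / \<rho> * norm (v - g)\<close>. For \<open>v\<close> the true gradient and
  \<open>g\<close> the momentum estimate, the right-hand side is the convergence measure, so the
  comparison holds on every sample path.\<close>

lemma norm_gradient_mapping_le:
  fixes X :: "(real^'n) set"
  assumes X: "X \<noteq> {}" "compact X" "convex X" and \<gamma>: "0 < \<gamma>" and \<rho>: "0 < \<rho>"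
    and H: "loewner_ge H (\<rho> *\<^sub>R mat 1)"
  shows "norm (gradient_mapping X H x v \<gamma>)
    \<le> 1 / \<rho> * norm (v - g) + 1 / \<gamma> * norm (prox_step X \<gamma> H x g - x)"
proof -
  let ?p = "prox_step X \<gamma> H x"
  have "norm (x - ?p v) \<le> norm (x - ?p g) + norm (?p g - ?p v)"
    using norm_triangle_ineq[of "x - ?p g" "?p g - ?p v"] by simp
  also have "norm (?p g - ?p v) \<le> \<gamma> / \<rho> * norm (v - g)"
    using prox_step_lipschitz[OF X \<gamma> H, of x g v] \<rho>
    by (simp add: pos_le_divide_eq mult_ac norm_minus_commute)
  finally have "1 / \<gamma> * norm (x - ?p v) \<le> 1 / \<gamma> * (norm (x - ?p g) + \<gamma> / \<rho> * norm (v - g))"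
    using \<gamma> by (intro mult_left_mono) auto
  also have "\<dots> = 1 / \<rho> * norm (v - g) + 1 / \<gamma> * norm (?p g - x)"
    using \<gamma> by (simp add: distrib_left norm_minus_commute)
  finally show ?thesis
    using \<gamma> by (simp add: gradient_mapping_def)
qed

section \<open>The iterates as a process adapted to the samples\<close>

locale super_adam_process =
  M: prob_space M + stochastic_gradient D X h grad \<sigma> L
  for M :: "'w measure" and D :: "'s measure" and X :: "(real^'n) set"
    and h :: "real^'n \<Rightarrow> 's \<Rightarrow> real^'n" and grad :: "real^'n \<Rightarrow> real^'n" and \<sigma> L :: real +
  fixes \<xi> :: "nat \<Rightarrow> 'w \<Rightarrow> 's" and H :: "nat \<Rightarrow> 'w \<Rightarrow> real^'n^'n"
    and x xt g :: "nat \<Rightarrow> 'w \<Rightarrow> real^'n" and x1 :: "real^'n" and \<mu> \<alpha> :: "nat \<Rightarrow> real" and \<gamma> \<rho> :: real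
  assumes X: "X \<noteq> {}" "compact X" "convex X" and x1: "x1 \<in> X" and \<gamma>_pos: "0 < \<gamma>" and \<rho>_pos: "0 < \<rho>"
    and indep: "M.indep_vars (\<lambda>_. D) \<xi> {1..}"
    and distr: "\<And>t. t \<ge> 1 \<Longrightarrow> distr M D (\<xi> t) = D"
    and H_measurable: "\<And>t. t \<ge> 1 \<Longrightarrow> H t \<in> borel_measurable (history M D \<xi> t)"
    and H_ge: "\<And>t \<omega>. t \<ge> 1 \<Longrightarrow> \<omega> \<in> space M \<Longrightarrow> loewner_ge (H t \<omega>) (\<rho> *\<^sub>R mat 1)"
    and \<mu>_range: "\<And>t. t \<ge> 1 \<Longrightarrow> 0 < \<mu> t \<and> \<mu> t \<le> 1"
    and x_1: "\<And>\<omega>. \<omega> \<in> space M \<Longrightarrow> x 1 \<omega> = x1"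
    and g_1: "\<And>\<omega>. \<omega> \<in> space M \<Longrightarrow> g 1 \<omega> = h x1 (\<xi> 1 \<omega>)"
    and xt_Suc: "\<And>t \<omega>. t \<ge> 1 \<Longrightarrow> \<omega> \<in> space M \<Longrightarrow> xt (Suc t) \<omega> = prox_step X \<gamma> (H t \<omega>) (x t \<omega>) (g t \<omega>)"
    and x_Suc: "\<And>t \<omega>. t \<ge> 1 \<Longrightarrow> \<omega> \<in> space M \<Longrightarrow>
      x (Suc t) \<omega> = (1 - \<mu> t) *\<^sub>R x t \<omega> + \<mu> t *\<^sub>R xt (Suc t) \<omega>"
    and g_Suc: "\<And>t \<omega>. t \<ge> 1 \<Longrightarrow> \<omega> \<in> space M \<Longrightarrow>
      g (Suc t) \<omega> = \<alpha> (Suc t) *\<^sub>R h (x (Suc t) \<omega>) (\<xi> (Suc t) \<omega>)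
        + (1 - \<alpha> (Suc t)) *\<^sub>R
          (g t \<omega> + (h (x (Suc t) \<omega>) (\<xi> (Suc t) \<omega>) - h (x t \<omega>) (\<xi> (Suc t) \<omega>)))"
begin

lemma \<xi>_measurable: "t \<ge> 1 \<Longrightarrow> \<xi> t \<in> measurable M D"
  using indep by (auto simp: M.indep_vars_def)

lemma xt_in_X:
  assumes "t \<ge> 1" "\<omega> \<in> space M"
  shows "xt (Suc t) \<omega> \<in> X"
  using xt_Suc[OF assms] prox_step_minimizes(1)[OF X(1,2)] by simp

lemma x_in_X:
  assumes "t \<ge> 1" "\<omega> \<in> space M"
  shows "x t \<omega> \<in> X"
  using assms(1)
proof (induction t rule: nat_induct_at_least)
  case base
  then show ?case using x_1 x1 assms(2) by simp
next
  case (Suc t)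
  then show ?case
    using convexD_alt[OF X(3) Suc.IH xt_in_X[OF Suc.hyps assms(2)], of "\<mu> t"] \<mu>_range[OF Suc.hyps]
    by (simp add: x_Suc[OF Suc.hyps assms(2)])
qed

text \<open>The locale gives measurability of \<open>h y\<close> only for fixed \<open>y\<close>;
  the Lipschitz property extends it to random points of \<open>X\<close>.\<close>

lemma h_compose_measurable:
  assumes "u \<in> borel_measurable N" "\<And>\<omega>. \<omega> \<in> space N \<Longrightarrow> u \<omega> \<in> X" "\<zeta> \<in> measurable N D"
  shows "(\<lambda>\<omega>. h (u \<omega>) (\<zeta> \<omega>)) \<in> borel_measurable N"
proof (rule borel_measurable_lipschitz_compose[where h = h and u = u and \<zeta> = \<zeta> and X = X and L = L and D = D])
  show "h y \<in> borel_measurable D" if "y \<in> X" for y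
    using h_int[OF that] by (rule borel_measurable_integrable)
qed (use h_lipschitz L_pos assms in simp_all)

lemma prox_step_compose_measurable:
  assumes [measurable]: "A \<in> borel_measurable N" "u \<in> borel_measurable N" "v \<in> borel_measurable N"
    and A: "\<And>\<omega>. \<omega> \<in> space N \<Longrightarrow> loewner_ge (A \<omega>) (\<rho> *\<^sub>R mat 1)"
  shows "(\<lambda>\<omega>. prox_step X \<gamma> (A \<omega>) (u \<omega>) (v \<omega>)) \<in> borel_measurable N"
proof -
  have "(\<lambda>\<omega>. (A \<omega>, u \<omega>, v \<omega>)) \<in> borel_measurable N"
    by measurable
  from borel_measurable_continuous_on_compose[OF continuous_on_prox_step[OF X \<gamma>_pos \<rho>_pos] this]
  show ?thesis
    using A by simp
qed

text \<open>The point \<open>x (Suc t)\<close> is determined by the first \<open>t\<close> samples,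
  before \<open>\<xi> (Suc t)\<close> is drawn. This predictability is what allows both evaluation
  points of the fresh gradient to be frozen in \<open>error_step\<close>.\<close>

lemma iterates_measurable:
  assumes "t \<ge> 1"
  shows "x t \<in> borel_measurable (history M D \<xi> t)" "g t \<in> borel_measurable (history M D \<xi> t)"
    "xt (Suc t) \<in> borel_measurable (history M D \<xi> t)"
    "x (Suc t) \<in> borel_measurable (history M D \<xi> t)"
proof -
  have xt: "xt (Suc t) \<in> borel_measurable (history M D \<xi> t)"
    "x (Suc t) \<in> borel_measurable (history M D \<xi> t)"
    if t: "t \<ge> 1" and [measurable]: "x t \<in> borel_measurable (history M D \<xi> t)"
      "g t \<in> borel_measurable (history M D \<xi> t)" for t
  proof -
    have "(\<lambda>\<omega>. prox_step X \<gamma> (H t \<omega>) (x t \<omega>) (g t \<omega>)) \<in> borel_measurable (history M D \<xi> t)"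
      using H_ge[OF t] by (intro prox_step_compose_measurable H_measurable[OF t]) auto
    then show [measurable]: "xt (Suc t) \<in> borel_measurable (history M D \<xi> t)"
      by (rule measurable_cong[THEN iffD2, rotated]) (use xt_Suc[OF t] in simp)
    have "(\<lambda>\<omega>. (1 - \<mu> t) *\<^sub>R x t \<omega> + \<mu> t *\<^sub>R xt (Suc t) \<omega>) \<in> borel_measurable (history M D \<xi> t)"
      by measurable
    then show "x (Suc t) \<in> borel_measurable (history M D \<xi> t)"
      by (rule measurable_cong[THEN iffD2, rotated]) (use x_Suc[OF t] in simp)
  qed
  have "x t \<in> borel_measurable (history M D \<xi> t) \<and> g t \<in> borel_measurable (history M D \<xi> t)"
    using assms
  proof (induction t rule: nat_induct_at_least)
    case base
    have "(\<lambda>\<omega>. h x1 (\<xi> 1 \<omega>)) \<in> borel_measurable (history M D \<xi> 1)"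
      using x1 by (intro h_compose_measurable measurable_history_sample[OF \<xi>_measurable]) auto
    then have "g 1 \<in> borel_measurable (history M D \<xi> 1)"
      by (rule measurable_cong[THEN iffD2, rotated]) (use g_1 in simp)
    moreover have "x 1 \<in> borel_measurable (history M D \<xi> 1)"
      by (rule measurable_cong[THEN iffD2, rotated, of "\<lambda>_. x1"]) (use x_1 in simp_all)
    ultimately show ?case by simp
  next
    case (Suc t)
    let ?N = "history M D \<xi> (Suc t)"
    have [measurable]: "x t \<in> borel_measurable ?N" "g t \<in> borel_measurable ?N"
      "x (Suc t) \<in> borel_measurable ?N"
      using Suc.IH xt(2)[OF Suc.hyps] by (auto intro: measurable_history_Suc[OF \<xi>_measurable])
    have s: "\<xi> (Suc t) \<in> measurable ?N D"
      by (rule measurable_history_sample[OF \<xi>_measurable]) auto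
    have [measurable]: "(\<lambda>\<omega>. h (x t \<omega>) (\<xi> (Suc t) \<omega>)) \<in> borel_measurable ?N"
      "(\<lambda>\<omega>. h (x (Suc t) \<omega>) (\<xi> (Suc t) \<omega>)) \<in> borel_measurable ?N"
      using Suc.hyps by (auto intro!: h_compose_measurable s x_in_X)
    have "(\<lambda>\<omega>. \<alpha> (Suc t) *\<^sub>R h (x (Suc t) \<omega>) (\<xi> (Suc t) \<omega>) + (1 - \<alpha> (Suc t)) *\<^sub>R
        (g t \<omega> + (h (x (Suc t) \<omega>) (\<xi> (Suc t) \<omega>) - h (x t \<omega>) (\<xi> (Suc t) \<omega>)))) \<in> borel_measurable ?N"
      by measurable
    then have "g (Suc t) \<in> borel_measurable ?N"
      by (rule measurable_cong[THEN iffD2, rotated]) (use g_Suc[OF Suc.hyps] in simp)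
    then show ?case
      by simp
  qed
  then show "x t \<in> borel_measurable (history M D \<xi> t)" "g t \<in> borel_measurable (history M D \<xi> t)"
    "xt (Suc t) \<in> borel_measurable (history M D \<xi> t)"
    "x (Suc t) \<in> borel_measurable (history M D \<xi> t)"
    using xt[OF assms] by auto
qed

lemma iterates_random_variable:
  assumes "t \<ge> 1"
  shows "x t \<in> borel_measurable M" "g t \<in> borel_measurable M" "xt (Suc t) \<in> borel_measurable M"
  by (rule measurable_from_history[OF \<xi>_measurable], assumption, rule iterates_measurable[OF assms])+

lemma grad_x_measurable:
  assumes "t \<ge> 1" "x t \<in> borel_measurable N" "space N = space M"
  shows "(\<lambda>\<omega>. grad (x t \<omega>)) \<in> borel_measurable N"
  by (rule borel_measurable_continuous_on_compose[OF continuous_on_grad assms(2)])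
     (use x_in_X[OF assms(1)] assms(3) in simp)

lemma error_Suc:
  assumes t: "t \<ge> 1" and \<omega>: "\<omega> \<in> space M"
  shows "grad (x (Suc t) \<omega>) - g (Suc t) \<omega> = (1 - \<alpha> (Suc t)) *\<^sub>R (grad (x t \<omega>) - g t \<omega>)
    + noise (\<alpha> (Suc t)) (x t \<omega>) (x (Suc t) \<omega>) (\<xi> (Suc t) \<omega>)"
  unfolding g_Suc[OF t \<omega>] noise_def
  by (simp add: scaleR_right_diff_distrib scaleR_left_diff_distrib scaleR_right_distrib)

lemma step_power2_integrable:
  assumes t: "t \<ge> 1"
  shows "integrable M (\<lambda>\<omega>. (norm (xt (Suc t) \<omega> - x t \<omega>))\<^sup>2)"
proof -
  obtain B where B: "\<And>y. y \<in> X \<Longrightarrow> norm y \<le> B"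
    using compact_imp_bounded[OF X(2)] by (auto simp: bounded_iff)
  note [measurable] = iterates_random_variable[OF t]
  have "(norm (xt (Suc t) \<omega> - x t \<omega>))\<^sup>2 \<le> (B + B)\<^sup>2" if "\<omega> \<in> space M" for \<omega>
    using norm_triangle_ineq4[of "xt (Suc t) \<omega>" "x t \<omega>"] B[OF xt_in_X[OF t that]] B[OF x_in_X[OF t that]]
    by (intro power_mono norm_ge_zero) linarith
  then show ?thesis
    by (intro M.integrable_const_bound[where B = "(B + B)\<^sup>2"]) auto
qed

text \<open>Freezing the past turns the new error into a constant plus centred noise, to which
  \<open>error_second_moment\<close> applies for each outcome. Because the computation runs in
  nonnegative integrals, a finite bound also proves integrability of the new squared error.\<close>

lemma error_step:
  assumes t: "t \<ge> 1" and int: "integrable M (\<lambda>\<omega>. (norm (grad (x t \<omega>) - g t \<omega>))\<^sup>2)"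
  shows "integrable M (\<lambda>\<omega>. (norm (grad (x (Suc t) \<omega>) - g (Suc t) \<omega>))\<^sup>2)"
    and "M.expectation (\<lambda>\<omega>. (norm (grad (x (Suc t) \<omega>) - g (Suc t) \<omega>))\<^sup>2)
      \<le> (1 - \<alpha> (Suc t))\<^sup>2 * M.expectation (\<lambda>\<omega>. (norm (grad (x t \<omega>) - g t \<omega>))\<^sup>2)
        + 2 * (\<alpha> (Suc t))\<^sup>2 * \<sigma>\<^sup>2
        + 2 * (1 - \<alpha> (Suc t))\<^sup>2 * L\<^sup>2 * (\<mu> t)\<^sup>2 * M.expectation (\<lambda>\<omega>. (norm (xt (Suc t) \<omega> - x t \<omega>))\<^sup>2)"
proof -
  let ?N = "history M D \<xi> t" and ?q = "\<alpha> (Suc t)"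
  let ?e = "\<lambda>t \<omega>. grad (x t \<omega>) - g t \<omega>"
  \<comment> \<open>\<open>\<omega>\<close> represents the past only and \<open>s\<close> is an
    independent copy of the next sample; on the diagonal \<open>s = \<xi> (Suc t) \<omega>\<close>
    this is the squared new error.\<close>
  let ?\<phi> = "\<lambda>(\<omega>, s). ennreal ((norm ((1 - ?q) *\<^sub>R ?e t \<omega> + noise ?q (x t \<omega>) (x (Suc t) \<omega>) s))\<^sup>2)"
  let ?b = "\<lambda>\<omega>. (1 - ?q)\<^sup>2 * (norm (?e t \<omega>))\<^sup>2 + 2 * ?q\<^sup>2 * \<sigma>\<^sup>2
      + 2 * (1 - ?q)\<^sup>2 * L\<^sup>2 * (\<mu> t)\<^sup>2 * (norm (xt (Suc t) \<omega> - x t \<omega>))\<^sup>2"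
  have t': "Suc t \<ge> 1"
    by simp
  note [measurable] = iterates_measurable[OF t]
  have [measurable]: "(\<lambda>\<omega>. grad (x t \<omega>)) \<in> borel_measurable ?N"
    "(\<lambda>\<omega>. grad (x (Suc t) \<omega>)) \<in> borel_measurable ?N"
    using t by (auto intro!: grad_x_measurable iterates_measurable)
  have [measurable]: "(\<lambda>z. h (x t (fst z)) (snd z)) \<in> borel_measurable (?N \<Otimes>\<^sub>M D)"
    "(\<lambda>z. h (x (Suc t) (fst z)) (snd z)) \<in> borel_measurable (?N \<Otimes>\<^sub>M D)"
    using t by (auto intro!: h_compose_measurable x_in_X simp: space_pair_measure)
  have \<phi>: "?\<phi> \<in> borel_measurable (?N \<Otimes>\<^sub>M D)"
    unfolding noise_def case_prod_beta by measurable
  have b: "integrable M ?b"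
    using int step_power2_integrable[OF t] by simp
  have b_nonneg: "0 \<le> ?b \<omega>" for \<omega>
    by simp
  have "(\<integral>\<^sup>+\<omega>. ennreal ((norm (?e (Suc t) \<omega>))\<^sup>2) \<partial>M) = (\<integral>\<^sup>+\<omega>. ?\<phi> (\<omega>, \<xi> (Suc t) \<omega>) \<partial>M)"
    by (intro nn_integral_cong) (simp add: error_Suc[OF t])
  also have "\<dots> = (\<integral>\<^sup>+\<omega>. \<integral>\<^sup>+s. ?\<phi> (\<omega>, s) \<partial>D \<partial>M)"
    by (rule M.nn_integral_fresh_sample[OF indep distr[OF t'] \<phi>])
  also have "\<dots> \<le> (\<integral>\<^sup>+\<omega>. ennreal (?b \<omega>) \<partial>M)"
  proof (rule nn_integral_mono)
    fix \<omega> assume \<omega>: "\<omega> \<in> space M"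
    have "x (Suc t) \<omega> - x t \<omega> = \<mu> t *\<^sub>R (xt (Suc t) \<omega> - x t \<omega>)"
      by (simp add: x_Suc[OF t \<omega>] algebra_simps)
    then show "(\<integral>\<^sup>+s. ?\<phi> (\<omega>, s) \<partial>D) \<le> ennreal (?b \<omega>)"
      using error_second_moment[OF x_in_X[OF t \<omega>] x_in_X[OF t' \<omega>], of "(1 - ?q) *\<^sub>R ?e t \<omega>" ?q]
      by (simp add: power_mult_distrib mult.assoc)
  qed
  also have "\<dots> = ennreal (M.expectation ?b)"
    using b b_nonneg by (intro nn_integral_eq_integral) auto
  finally have le: "(\<integral>\<^sup>+\<omega>. ennreal ((norm (?e (Suc t) \<omega>))\<^sup>2) \<partial>M) \<le> ennreal (M.expectation ?b)" .
  have "(\<lambda>\<omega>. ?e (Suc t) \<omega>) \<in> borel_measurable M"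
    using iterates_random_variable[OF t'] grad_x_measurable[OF t' iterates_random_variable(1)[OF t']]
    by measurable
  then have meas: "(\<lambda>\<omega>. (norm (?e (Suc t) \<omega>))\<^sup>2) \<in> borel_measurable M"
    by measurable
  show int': "integrable M (\<lambda>\<omega>. (norm (?e (Suc t) \<omega>))\<^sup>2)"
    using le_less_trans[OF le] by (intro integrableI_bounded meas) simp
  have "ennreal (M.expectation (\<lambda>\<omega>. (norm (?e (Suc t) \<omega>))\<^sup>2)) \<le> ennreal (M.expectation ?b)"
    using le nn_integral_eq_integral[OF int'] by simp
  then have "M.expectation (\<lambda>\<omega>. (norm (?e (Suc t) \<omega>))\<^sup>2) \<le> M.expectation ?b"
    using Bochner_Integration.integral_nonneg[OF b_nonneg] by (subst (asm) ennreal_le_iff)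
  also have "\<dots> = (1 - ?q)\<^sup>2 * M.expectation (\<lambda>\<omega>. (norm (?e t \<omega>))\<^sup>2) + 2 * ?q\<^sup>2 * \<sigma>\<^sup>2
      + 2 * (1 - ?q)\<^sup>2 * L\<^sup>2 * (\<mu> t)\<^sup>2 * M.expectation (\<lambda>\<omega>. (norm (xt (Suc t) \<omega> - x t \<omega>))\<^sup>2)"
    using int step_power2_integrable[OF t] by (simp add: M.prob_space)
  finally show "M.expectation (\<lambda>\<omega>. (norm (?e (Suc t) \<omega>))\<^sup>2) \<le> \<dots>" .
qed

lemma error_first:
  shows "integrable M (\<lambda>\<omega>. (norm (grad (x 1 \<omega>) - g 1 \<omega>))\<^sup>2)"
    and "M.expectation (\<lambda>\<omega>. (norm (grad (x 1 \<omega>) - g 1 \<omega>))\<^sup>2) \<le> \<sigma>\<^sup>2"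
proof -
  have \<xi>: "\<xi> 1 \<in> measurable M D" "distr M D (\<xi> 1) = D"
    using \<xi>_measurable distr by auto
  let ?v = "\<lambda>s. (norm (grad x1 - h x1 s))\<^sup>2"
  have v: "integrable D ?v" "D.expectation ?v \<le> \<sigma>\<^sup>2"
    using variance_int[OF x1] variance_le[OF x1] by (simp_all add: norm_minus_commute)
  have eq: "(norm (grad (x 1 \<omega>) - g 1 \<omega>))\<^sup>2 = ?v (\<xi> 1 \<omega>)" if "\<omega> \<in> space M" for \<omega>
    using x_1[OF that] g_1[OF that] by simp
  have "integrable M (\<lambda>\<omega>. ?v (\<xi> 1 \<omega>))"
    using integrable_distr[OF \<xi>(1), of ?v] v \<xi>(2) by simp
  then show "integrable M (\<lambda>\<omega>. (norm (grad (x 1 \<omega>) - g 1 \<omega>))\<^sup>2)"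
    by (subst Bochner_Integration.integrable_cong[OF refl eq])
  have "M.expectation (\<lambda>\<omega>. (norm (grad (x 1 \<omega>) - g 1 \<omega>))\<^sup>2) = M.expectation (\<lambda>\<omega>. ?v (\<xi> 1 \<omega>))"
    by (rule Bochner_Integration.integral_cong[OF refl eq])
  also have "\<dots> = D.expectation ?v"
    using integral_distr[OF \<xi>(1), of ?v] v(1) \<xi>(2) by simp
  finally show "M.expectation (\<lambda>\<omega>. (norm (grad (x 1 \<omega>) - g 1 \<omega>))\<^sup>2) \<le> \<sigma>\<^sup>2"
    using v(2) by simp
qed

lemma error_integrable:
  assumes "t \<ge> 1"
  shows "integrable M (\<lambda>\<omega>. (norm (grad (x t \<omega>) - g t \<omega>))\<^sup>2)"
  using assms by (induction t rule: nat_induct_at_least) (fact error_first(1), fact error_step(1))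

end

section \<open>Convergence rate\<close>

theorem theorem1:
  fixes X U :: "(real^'n) set"
    and D :: "'s measure"
    and F :: "real^'n \<Rightarrow> 's \<Rightarrow> real"
    and f :: "real^'n \<Rightarrow> real"
    and M :: "'w measure"
    and \<xi> :: "nat \<Rightarrow> 'w \<Rightarrow> 's"
    and R :: "nat \<Rightarrow> (nat \<Rightarrow> 's) \<Rightarrow> real^'n^'n"
    and H :: "nat \<Rightarrow> 'w \<Rightarrow> real^'n^'n"
    and x xt g :: "nat \<Rightarrow> 'w \<Rightarrow> real^'n"
    and x1 :: "real^'n"
    and \<mu> \<alpha> :: "nat \<Rightarrow> real"
    and \<sigma> \<rho> L k m \<gamma> c fstar G :: real
    and T :: nat
  assumes X: "X \<noteq> {}" "compact X" "convex X"
    and U: "open U" "X \<subseteq> U"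
    and D: "prob_space D"
    and F_diff: "\<And>s y. s \<in> space D \<Longrightarrow> y \<in> U \<Longrightarrow> (\<lambda>y. F y s) differentiable (at y)"
    and F_int: "\<And>y. y \<in> U \<Longrightarrow> integrable D (F y)"
    and f_eq: "\<And>y. y \<in> U \<Longrightarrow> f y = (\<integral>s. F y s \<partial>D)"
    and f_diff: "\<And>y. y \<in> U \<Longrightarrow> f differentiable (at y)"
    and M: "prob_space M"
    and \<xi>_indep: "prob_space.indep_vars M (\<lambda>_. D) \<xi> {1..}"
    and \<xi>_distr: "\<And>t. t \<ge> 1 \<Longrightarrow> distr M D (\<xi> t) = D"
    and R_meas: "\<And>t. t \<ge> 1 \<Longrightarrow> R t \<in> borel_measurable (Pi\<^sub>M {1..t} (\<lambda>_. D))"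
    and H_eq: "\<And>t \<omega>. t \<ge> 1 \<Longrightarrow> \<omega> \<in> space M \<Longrightarrow> H t \<omega> = R t (\<lambda>i\<in>{1..t}. \<xi> i \<omega>)"
    and run: "\<And>\<omega>. \<omega> \<in> space M \<Longrightarrow>
      super_adam_run X F 1 \<gamma> \<mu> \<alpha> x1 (\<lambda>t. \<xi> t \<omega>) (\<lambda>t. H t \<omega>) (\<lambda>t. x t \<omega>) (\<lambda>t. xt t \<omega>) (\<lambda>t. g t \<omega>)"
    and \<sigma>: "\<sigma> > 0"
    and grad_int: "\<And>y. y \<in> X \<Longrightarrow> integrable D (\<lambda>s. gradient (\<lambda>y. F y s) y)"
    and unbiased: "\<And>y. y \<in> X \<Longrightarrow> (\<integral>s. gradient (\<lambda>y. F y s) y \<partial>D) = gradient f y"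
    and var_int: "\<And>y. y \<in> X \<Longrightarrow>
      integrable D (\<lambda>s. (norm (gradient (\<lambda>y. F y s) y - gradient f y))\<^sup>2)"
    and variance: "\<And>y. y \<in> X \<Longrightarrow>
      (\<integral>s. (norm (gradient (\<lambda>y. F y s) y - gradient f y))\<^sup>2 \<partial>D) \<le> \<sigma>\<^sup>2"
    and f_bdd: "bdd_below (f ` X)"
    and fstar: "fstar = (INF y\<in>X. f y)"
    and \<rho>: "\<rho> > 0"
    and H_ge: "\<And>t \<omega>. t \<ge> 1 \<Longrightarrow> \<omega> \<in> space M \<Longrightarrow> loewner_ge (H t \<omega>) (\<rho> *\<^sub>R mat 1)"
    and L: "L > 0"
    and smooth: "\<And>s y z. s \<in> space D \<Longrightarrow> y \<in> X \<Longrightarrow> z \<in> X \<Longrightarrow>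
      norm (gradient (\<lambda>y. F y s) y - gradient (\<lambda>y. F y s) z) \<le> L * norm (y - z)"
    and k: "k > 0"
    and m: "m \<ge> Max {3 / 2, k ^ 3, 8 powr (3 / 2) / (3 * k) powr (3 / 2)}"
    and \<gamma>: "0 < \<gamma>" "\<gamma> \<le> \<rho> * m powr (1 / 3) / (4 * k * L)"
    and c: "1 / k ^ 3 + 10 * L\<^sup>2 * \<gamma>\<^sup>2 / \<rho>\<^sup>2 \<le> c" "c \<le> m powr (2 / 3) / k\<^sup>2"
    and \<mu>: "\<And>t. \<mu> t = k / (m + real t) powr (1 / 3)"
    and \<alpha>: "\<And>t. \<alpha> (Suc t) = c * (\<mu> t)\<^sup>2"
    and G: "G = (f x1 - fstar) / (k * \<rho> * \<gamma>)
              + m powr (1 / 3) * \<sigma>\<^sup>2 / (8 * k\<^sup>2 * L\<^sup>2 * \<gamma>\<^sup>2)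
              + k\<^sup>2 * c\<^sup>2 * \<sigma>\<^sup>2 / (4 * L\<^sup>2 * \<gamma>\<^sup>2) * ln (m + real T)"
    and T: "T \<ge> 1"
  shows "(\<forall>t\<in>{1..T}.
            integrable M (\<lambda>\<omega>. norm (gradient_mapping X (H t \<omega>) (x t \<omega>) (gradient f (x t \<omega>)) \<gamma>)) \<and>
            integrable M (\<lambda>\<omega>. convergence_measure \<rho> \<gamma> f (x t \<omega>) (g t \<omega>) (xt (Suc t) \<omega>))) \<and>
         1 / real T * (\<Sum>t=1..T. prob_space.expectation M
            (\<lambda>\<omega>. norm (gradient_mapping X (H t \<omega>) (x t \<omega>) (gradient f (x t \<omega>)) \<gamma>)))
          \<le> 1 / real T * (\<Sum>t=1..T. prob_space.expectation M
            (\<lambda>\<omega>. convergence_measure \<rho> \<gamma> f (x t \<omega>) (g t \<omega>) (xt (Suc t) \<omega>))) \<and>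
         1 / real T * (\<Sum>t=1..T. prob_space.expectation M
            (\<lambda>\<omega>. convergence_measure \<rho> \<gamma> f (x t \<omega>) (g t \<omega>) (xt (Suc t) \<omega>)))
          \<le> 2 * sqrt (2 * G) * m powr (1 / 6) / real T powr (1 / 2)
            + 2 * sqrt (2 * G) / real T powr (1 / 3)"
proof -
  interpret D: prob_space D by fact
  interpret M: prob_space M by fact
  define h where "h y s = gradient (\<lambda>y. F y s) y" for y s
  have run': "0 < \<gamma> \<and> x1 \<in> X \<and> (\<forall>t\<ge>1. \<mu> t \<in> {0<..1} \<and> \<alpha> (Suc t) \<in> {0<..1}) \<and>
      x 1 \<omega> = x1 \<and> g 1 \<omega> = h x1 (\<xi> 1 \<omega>) \<and>
      (\<forall>t\<ge>1. xt (Suc t) \<omega> = prox_step X \<gamma> (H t \<omega>) (x t \<omega>) (g t \<omega>) \<and>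
        x (Suc t) \<omega> = (1 - \<mu> t) *\<^sub>R x t \<omega> + \<mu> t *\<^sub>R xt (Suc t) \<omega> \<and>
        g (Suc t) \<omega> = \<alpha> (Suc t) *\<^sub>R h (x (Suc t) \<omega>) (\<xi> (Suc t) \<omega>)
        + (1 - \<alpha> (Suc t)) *\<^sub>R
          (g t \<omega> + (h (x (Suc t) \<omega>) (\<xi> (Suc t) \<omega>) - h (x t \<omega>) (\<xi> (Suc t) \<omega>))))"
    if "\<omega> \<in> space M" for \<omega>
    using run[OF that] unfolding super_adam_run_def h_def scaleR_one by blast
  \<comment> \<open>The deterministic conditions on \<open>x1\<close>, \<open>\<mu>\<close> and
    \<open>\<alpha>\<close> are part of the run predicate, hence available only along an outcome;
    one outcome is enough.\<close>
  obtain \<omega>\<^sub>0 where \<omega>\<^sub>0: "\<omega>\<^sub>0 \<in> space M"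
    using M.not_empty by blast
  have x1: "x1 \<in> X" and \<mu>_range: "0 < \<mu> t \<and> \<mu> t \<le> 1" and \<alpha>_le: "\<alpha> (Suc t) \<le> 1" if "t \<ge> 1" for t
    using run'[OF \<omega>\<^sub>0] that by auto
  have samples: "\<xi> t \<in> measurable M D" if "t \<ge> 1" for t
    using \<xi>_indep that by (auto simp: M.indep_vars_def)
  have H_measurable: "H t \<in> borel_measurable (history M D \<xi> t)" if t: "t \<ge> 1" for t
    by (rule measurable_cong[THEN iffD2, OF _ measurable_compose[OF measurable_history_samples R_meas[OF t]]])
       (use H_eq[OF t] samples in auto)
  interpret super_adam_process M D X h "gradient f" \<sigma> L \<xi> H x xt g x1 \<mu> \<alpha> \<gamma> \<rho>
  proof unfold_locales
    show "integrable D (h y)" if "y \<in> X" for y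
      using grad_int[OF that] by (simp add: h_def[abs_def])
    show "D.expectation (h y) = gradient f y" if "y \<in> X" for y
      using unbiased[OF that] by (simp add: h_def[abs_def])
  qed (use X \<gamma> \<rho> L x1[of 1] \<xi>_indep \<xi>_distr H_measurable H_ge \<mu>_range run' var_int variance smooth
      in \<open>simp_all add: h_def\<close>)
  have m_bounds: "1 \<le> m" "k ^ 3 \<le> m"
    using m by auto
  have f_cont: "continuous_on X f"
    using f_diff U(2) by (meson continuous_at_imp_continuous_on differentiable_imp_continuous_within subsetD)
  have f_X: "fstar \<le> f y" if "y \<in> X" for y
    unfolding fstar using f_bdd that by (rule cINF_lower)
  \<comment> \<open>The upper bound on \<open>\<gamma>\<close> is this inequality at
    \<open>t = 0\<close>; later step sizes are smaller.\<close>
  have step_size: "4 * L * \<gamma> * \<mu> t \<le> \<rho>" for t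
  proof -
    have "4 * L * \<gamma> * \<mu> t \<le> 4 * L * (\<rho> * m powr (1 / 3) / (4 * k * L)) * \<mu> t"
      using \<gamma>(2) L k m_bounds by (intro mult_right_mono mult_left_mono) (auto simp: \<mu>)
    also have "\<dots> = \<rho> * (m powr (1 / 3) / (m + real t) powr (1 / 3))"
      using L k by (simp add: \<mu>)
    also have "\<dots> \<le> \<rho> * 1"
      using \<rho> m_bounds by (intro mult_left_mono) (auto simp: powr_mono2)
    finally show ?thesis by simp
  qed
  define e d where "e t \<omega> = norm (gradient f (x t \<omega>) - g t \<omega>)"
    and "d t \<omega> = norm (xt (Suc t) \<omega> - x t \<omega>)" for t \<omega>
  define a b where "a t = M.expectation (\<lambda>\<omega>. (e t \<omega>)\<^sup>2)"
    and "b t = M.expectation (\<lambda>\<omega>. (d t \<omega>)\<^sup>2)" for t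
  have e2: "integrable M (\<lambda>\<omega>. (e t \<omega>)\<^sup>2)" and d2: "integrable M (\<lambda>\<omega>. (d t \<omega>)\<^sup>2)" if "t \<ge> 1" for t
    using error_integrable[OF that] step_power2_integrable[OF that] by (simp_all add: e_def d_def)
  have e1: "integrable M (e t)" and d1: "integrable M (d t)" if t: "t \<ge> 1" for t
  proof -
    note [measurable] = iterates_random_variable[OF t] grad_x_measurable[OF t iterates_random_variable(1)[OF t]]
    show "integrable M (e t)"
      by (rule M.integrable_of_power2[OF _ e2[OF t]]) (simp add: e_def[abs_def])
    show "integrable M (d t)"
      by (rule M.integrable_of_power2[OF _ d2[OF t]]) (simp add: d_def[abs_def])
  qed
  have f_int: "integrable M (\<lambda>\<omega>. f (x t \<omega>))" if t: "t \<ge> 1" for t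
  proof -
    obtain B where B: "\<And>y. y \<in> X \<Longrightarrow> norm (f y) \<le> B"
      using compact_imp_bounded[OF compact_continuous_image[OF f_cont X(2)]] by (auto simp: bounded_iff)
    have "(\<lambda>\<omega>. f (x t \<omega>)) \<in> borel_measurable M"
      using x_in_X[OF t] by (rule borel_measurable_continuous_on_compose[OF f_cont iterates_random_variable(1)[OF t]])
    then show ?thesis
      by (rule M.integrable_const_bound[rotated]) (use B x_in_X[OF t] in auto)
  qed
  \<comment> \<open>The Lyapunov recursion is run on expectations: its \<open>\<phi> t\<close> is
    the expected objective at \<open>x t\<close>, and its \<open>a\<close> and \<open>b\<close> are
    the second moments of error and displacement.\<close>
  have "(\<Sum>t=1..T. a t / \<rho>\<^sup>2 + b t / \<gamma>\<^sup>2)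
    \<le> 4 * ((M.expectation (\<lambda>\<omega>. f (x 1 \<omega>)) - fstar) / (k * \<rho> * \<gamma>) + m powr (1 / 3) * \<sigma>\<^sup>2 / (8 * k\<^sup>2 * L\<^sup>2 * \<gamma>\<^sup>2)
          + k\<^sup>2 * c\<^sup>2 * \<sigma>\<^sup>2 / (4 * L\<^sup>2 * \<gamma>\<^sup>2) * ln (m + real T)) * (m + real T) powr (1 / 3)"
  proof (rule momentum_lyapunov_bound[OF \<rho> \<gamma>(1) L k m_bounds c(1) \<mu>])
    fix t :: nat assume t: "1 \<le> t"
    show "c * (\<mu> t)\<^sup>2 \<le> 1"
      using \<alpha>_le[OF t] by (simp add: \<alpha>)
    show "0 \<le> a t" "0 \<le> b t"
      by (simp_all add: a_def b_def)
    show "a (Suc t) \<le> (1 - c * (\<mu> t)\<^sup>2)\<^sup>2 * a t + 2 * (c * (\<mu> t)\<^sup>2)\<^sup>2 * \<sigma>\<^sup>2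
        + 2 * (1 - c * (\<mu> t)\<^sup>2)\<^sup>2 * L\<^sup>2 * (\<mu> t)\<^sup>2 * b t"
      using error_step(2)[OF t error_integrable[OF t]] by (simp only: a_def b_def e_def d_def \<alpha>)
    have "M.expectation (\<lambda>\<omega>. f (x (Suc t) \<omega>)) \<le> M.expectation (\<lambda>\<omega>.
        f (x t \<omega>) + \<mu> t * \<gamma> / \<rho> * (e t \<omega>)\<^sup>2 - \<rho> * \<mu> t / (2 * \<gamma>) * (d t \<omega>)\<^sup>2)"
    proof (rule integral_mono)
      fix \<omega> assume \<omega>: "\<omega> \<in> space M"
      show "f (x (Suc t) \<omega>) \<le> f (x t \<omega>) + \<mu> t * \<gamma> / \<rho> * (e t \<omega>)\<^sup>2 - \<rho> * \<mu> t / (2 * \<gamma>) * (d t \<omega>)\<^sup>2"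
        unfolding x_Suc[OF t \<omega>] e_def d_def xt_Suc[OF t \<omega>]
        using f_diff U(2) \<mu>_range[OF t] step_size[of t] x_in_X[OF t \<omega>]
        by (intro proximal_step_decrease[OF X \<gamma>(1) \<rho> L H_ge[OF t \<omega>]] grad_lipschitz) auto
    qed (use f_int t e2 d2 in auto)
    also have "\<dots> = M.expectation (\<lambda>\<omega>. f (x t \<omega>)) + \<mu> t * \<gamma> / \<rho> * a t - \<rho> * \<mu> t / (2 * \<gamma>) * b t"
      using f_int[OF t] e2[OF t] d2[OF t] by (simp add: a_def b_def)
    finally show "M.expectation (\<lambda>\<omega>. f (x (Suc t) \<omega>))
      \<le> M.expectation (\<lambda>\<omega>. f (x t \<omega>)) + \<mu> t * \<gamma> / \<rho> * a t - \<rho> * \<mu> t / (2 * \<gamma>) * b t" .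
    show "fstar \<le> M.expectation (\<lambda>\<omega>. f (x t \<omega>))"
      using f_X x_in_X[OF t] by (intro M.integral_ge_const f_int[OF t]) auto
  next
    show "a 1 \<le> \<sigma>\<^sup>2"
      using error_first(2) by (simp only: a_def e_def)
  qed
  moreover have "M.expectation (\<lambda>\<omega>. f (x 1 \<omega>)) = M.expectation (\<lambda>_. f x1)"
    by (rule Bochner_Integration.integral_cong) (simp_all only: x_1)
  ultimately have total: "(\<Sum>t=1..T. a t / \<rho>\<^sup>2 + b t / \<gamma>\<^sup>2) \<le> 4 * G * (m + real T) powr (1 / 3)"
    by (simp add: G M.prob_space)
  let ?M = "\<lambda>t \<omega>. convergence_measure \<rho> \<gamma> f (x t \<omega>) (g t \<omega>) (xt (Suc t) \<omega>)"
  let ?G = "\<lambda>t \<omega>. norm (gradient_mapping X (H t \<omega>) (x t \<omega>) (gradient f (x t \<omega>)) \<gamma>)"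
  have M_eq: "?M t \<omega> = 1 / \<rho> * e t \<omega> + 1 / \<gamma> * d t \<omega>" for t \<omega>
    by (simp add: convergence_measure_def e_def d_def)
  have M_int: "integrable M (?M t)" if "t \<ge> 1" for t
    unfolding M_eq using e1[OF that] d1[OF that] by simp
  have G_le: "?G t \<omega> \<le> ?M t \<omega>" if "t \<ge> 1" "\<omega> \<in> space M" for t \<omega>
    using norm_gradient_mapping_le[OF X \<gamma>(1) \<rho> H_ge[OF that]]
    by (simp only: convergence_measure_def xt_Suc[OF that])
  have G_int: "integrable M (?G t)" if t: "t \<ge> 1" for t
  proof (rule Bochner_Integration.integrable_bound[OF M_int[OF t]])
    note [measurable] = iterates_random_variable[OF t] grad_x_measurable[OF t iterates_random_variable(1)[OF t]]
      measurable_from_history[OF samples H_measurable[OF t]]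
    have [measurable]: "(\<lambda>\<omega>. prox_step X \<gamma> (H t \<omega>) (x t \<omega>) (gradient f (x t \<omega>))) \<in> borel_measurable M"
      using H_ge[OF t] by (intro prox_step_compose_measurable) auto
    show "?G t \<in> borel_measurable M"
      unfolding gradient_mapping_def by measurable
    show "AE \<omega> in M. norm (?G t \<omega>) \<le> norm (?M t \<omega>)"
      using order_trans[OF G_le[OF t] abs_ge_self] by simp
  qed
  \<comment> \<open>Jensen's inequality moves the square inside the expectation, and splitting the
    squared sum of the two norms gives the factor 2 expected by
    \<open>average_le_of_square_sum\<close>.\<close>
  have square: "(M.expectation (?M t))\<^sup>2 \<le> 2 * (a t / \<rho>\<^sup>2 + b t / \<gamma>\<^sup>2)" if t: "t \<ge> 1" for t
  proof -
    have le: "(?M t \<omega>)\<^sup>2 \<le> 2 * (1 / \<rho>\<^sup>2 * (e t \<omega>)\<^sup>2) + 2 * (1 / \<gamma>\<^sup>2 * (d t \<omega>)\<^sup>2)" for \<omega>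
      using norm_add_power2_le[of "1 / \<rho> * e t \<omega>" "1 / \<gamma> * d t \<omega>"]
      by (simp add: M_eq power_mult_distrib power_divide)
    have int: "integrable M (\<lambda>\<omega>. 2 * (1 / \<rho>\<^sup>2 * (e t \<omega>)\<^sup>2) + 2 * (1 / \<gamma>\<^sup>2 * (d t \<omega>)\<^sup>2))"
      using e2[OF t] d2[OF t] by simp
    have M2: "integrable M (\<lambda>\<omega>. (?M t \<omega>)\<^sup>2)"
    proof (rule Bochner_Integration.integrable_bound[OF int])
      show "(\<lambda>\<omega>. (?M t \<omega>)\<^sup>2) \<in> borel_measurable M"
        using borel_measurable_integrable[OF M_int[OF t]] by measurable
      show "AE \<omega> in M. norm ((?M t \<omega>)\<^sup>2)
          \<le> norm (2 * (1 / \<rho>\<^sup>2 * (e t \<omega>)\<^sup>2) + 2 * (1 / \<gamma>\<^sup>2 * (d t \<omega>)\<^sup>2))"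
        using order_trans[OF le abs_ge_self] by simp
    qed
    have "(M.expectation (?M t))\<^sup>2 \<le> M.expectation (\<lambda>\<omega>. (?M t \<omega>)\<^sup>2)"
      by (rule M.expectation_power2_le[OF M_int[OF t] M2])
    also have "\<dots> \<le> M.expectation (\<lambda>\<omega>. 2 * (1 / \<rho>\<^sup>2 * (e t \<omega>)\<^sup>2) + 2 * (1 / \<gamma>\<^sup>2 * (d t \<omega>)\<^sup>2))"
      using le by (intro integral_mono M2 int)
    also have "\<dots> = 2 * (a t / \<rho>\<^sup>2 + b t / \<gamma>\<^sup>2)"
      using e2[OF t] d2[OF t] by (simp add: a_def b_def)
    finally show ?thesis .
  qed
  have "1 / real T * (\<Sum>t=1..T. M.expectation (?M t))
      \<le> 2 * sqrt (2 * G) * m powr (1 / 6) / real T powr (1 / 2) + 2 * sqrt (2 * G) / real T powr (1 / 3)"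
    using m_bounds square by (intro average_le_of_square_sum[OF T _ _ total]) auto
  moreover have "1 / real T * (\<Sum>t=1..T. M.expectation (?G t)) \<le> 1 / real T * (\<Sum>t=1..T. M.expectation (?M t))"
    using G_le by (intro mult_left_mono sum_mono integral_mono G_int M_int) auto
  ultimately show ?thesis
    using G_int M_int by simp
qed

end
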